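(* Let $\Omega=\Omega^{(l)}\cup\Omega^{(r)}$ be the two-block domain described in the context, with embedding operator $E\in\mathbb{R}^{N\times\hat N}$, non-reduced inner product matrix $H_\Omega^+$, non-reduced derivative operators $D_x^+,D_y^+$, modified non-reduced Laplace operator $\tilde D_L^+$, and boundary operators $e_{\partial\Omega_i},d_{\partial\Omega_i},H_{\partial\Omega_i}$ ($i=1,2,3$). Then the reduced Laplace operator $$D_L = H_\Omega^{-1}E^\top H_\Omega^+\tilde D_L^+E,\qquad\text{where}\qquad H_\Omega=E^\top H_\Omega^+E,$$ satisfies the SBP property $$(\mathbf{u},D_L\mathbf{v})_{H_\Omega}=-(D_x^+E\mathbf{u},D_x^+E\mathbf{v})_{H_\Omega^+}-(D_y^+E\mathbf{u},D_y^+E\mathbf{v})_{H_\Omega^+}+\langle e_{\partial\Omega}\mathbf{u},d_{\partial\Omega}\mathbf{v}\rangle_{H_{\partial\Omega}}\qquad\text{for all }\mathbf{u},\mathbf{v}\in\mathbb{R}^{\hat N},$$ where the boundary terms are given by $$\langle e_{\partial\Omega}\mathbf{u},d_{\partial\Omega}\mathbf{v}\rangle_{H_{\partial\Omega}}=\sum_{i=1,2,3}\langle e_{\partial\Omega_i}\mathbf{u},d_{\partial\Omega_i}\mathbf{v}\rangle_{H_{\partial\Omega_i}}.$$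
   Context: Notation: for a square matrix $M$, $(\mathbf{a},\mathbf{b})_M=\mathbf{a}^\top M\mathbf{b}$, and for boundary quadratures $\langle\mathbf{a},\mathbf{b}\rangle_M=\mathbf{a}^\top M\mathbf{b}$. One-dimensional operators. Fix $m$ grid points $0=x_1<\dots<x_m=1$ (endpoints included; in the paper Gauss-Lobatto points), a diagonal matrix $H\in\mathbb{R}^{m\times m}$ with positive diagonal (quadrature weights), $e_l=[1,0,\dots,0]^\top$, $e_r=[0,\dots,0,1]^\top\in\mathbb{R}^m$, and a first derivative SBP operator $D_1\in\mathbb{R}^{m\times m}$, $D_1\approx\partial/\partial x$, i.e. $HD_1+D_1^\top H=-e_le_l^\top+e_re_r^\top$. Two-dimensional reference operators on $[0,1]^2$ with coordinates $(\xi,\eta)$ (grid values ordered with $\eta$ running fastest): $D_\xi=D_1\otimes I_m$, $D_\eta=I_m\otimes D_1$, $H_\xi=H\otimes I_m$, $H_\eta=I_m\otimes H$, $e_w=e_l^\top\otimes I_m$, $e_e=e_r^\top\otimes I_m$, $e_s=I_m\otimes e_l^\top$, $e_n=I_m\otimes e_r^\top$. For a diagonal matrix $b\in\mathbb{R}^{m^2\times m^2}$, $D_{\xi\xi}^{(b)}=D_\xi bD_\xi$ and $D_{\eta\eta}^{(b)}=D_\eta bD_\eta$ (variable-coefficient second derivatives obtained line by line by applying $D_1$ twice). Single curvilinear block. A block is the image of $[0,1]^2$ under a map $(x(\xi,\eta),y(\xi,\eta))$; $\mathbf{x},\mathbf{y}\in\mathbb{R}^{m^2}$ are the coordinates of its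 grid points. Set $X_\xi=\mathrm{diag}(D_\xi\mathbf{x})$, $X_\eta=\mathrm{diag}(D_\eta\mathbf{x})$, $Y_\xi=\mathrm{diag}(D_\xi\mathbf{y})$, $Y_\eta=\mathrm{diag}(D_\eta\mathbf{y})$, $J=X_\xi Y_\eta-X_\eta Y_\xi$ (assumed to have positive diagonal), $\alpha_1=J^{-1}(X_\eta^2+Y_\eta^2)$, $\beta=-J^{-1}(X_\xi X_\eta+Y_\xi Y_\eta)$, $\alpha_2=J^{-1}(X_\xi^2+Y_\xi^2)$, $W_1=\sqrt{X_\xi^2+Y_\xi^2}$, $W_2=\sqrt{X_\eta^2+Y_\eta^2}$. The block operators are: - Laplace operator $J^{-1}(D_{\xi\xi}^{(\alpha_1)}+D_\eta\beta D_\xi+D_\xi\beta D_\eta+D_{\eta\eta}^{(\alpha_2)})$; - $D_x=J^{-1}(Y_\eta D_\xi-Y_\xi D_\eta)$, $D_y=J^{-1}(-X_\eta D_\xi+X_\xi D_\eta)$; - inner product matrix $H_\xi H_\eta J$; - boundary quadratures $H_w=He_wW_2e_w^\top$, $H_e=He_eW_2e_e^\top$, $H_s=He_sW_1e_s^\top$, $H_n=He_nW_1e_n^\top$; - normal derivatives $d_k=n_k^{(1)}e_kD_x+n_k^{(2)}e_kD_y$, $k\in\{w,e,s,n\}$, where $n_k^{(1)},n_k^{(2)}$ are the $m\times m$ diagonal matrices of the components of the outward unit normal at the boundary points, computed with the discrete metric: $(n_e^{(1)},n_e^{(2)})=(e_eW_2^{-1}Y_\eta e_e^\top,\,-e_eW_2^{-1}X_\eta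 e_e^\top)$, $(n_w^{(1)},n_w^{(2)})=(-e_wW_2^{-1}Y_\eta e_w^\top,\,e_wW_2^{-1}X_\eta e_w^\top)$, $(n_n^{(1)},n_n^{(2)})=(-e_nW_1^{-1}Y_\xi e_n^\top,\,e_nW_1^{-1}X_\xi e_n^\top)$, $(n_s^{(1)},n_s^{(2)})=(e_sW_1^{-1}Y_\xi e_s^\top,\,-e_sW_1^{-1}X_\xi e_s^\top)$. Two-block domain. Superscripts $(l),(r)$ denote quantities of the left and right block. Both blocks use the same one-dimensional operators on the reference domain. The east side of $\Omega^{(l)}$ and the west side of $\Omega^{(r)}$ form the interface, and grid points there coincide: $e_e^{(l)}\mathbf{x}^{(l)}=e_w^{(r)}\mathbf{x}^{(r)}$, $e_e^{(l)}\mathbf{y}^{(l)}=e_w^{(r)}\mathbf{y}^{(r)}$; no other grid points coincide. Let $H_{\Omega^{(l)}},H_{\Omega^{(r)}}$ be the block inner product matrices, $D_L^{(l)},D_L^{(r)}$ the block Laplace operators, and let $$H_\Omega^+=\begin{bmatrix}H_{\Omega^{(l)}}&0\\0&H_{\Omega^{(r)}}\end{bmatrix},\quad D_L^+=\begin{bmatrix}D_L^{(l)}&0\\0&D_L^{(r)}\end{bmatrix},\quad D_x^+=\begin{bmatrix}D_x^{(l)}&0\\0&D_x^{(r)}\end{bmatrix},\quad D_y^+=\begin{bmatrix}D_y^{(l)}&0\\0&D_y^{(r)}\end{bmatrix}.$$ Embedding operator. Let $N=2m^2$, let $\mathbf{S}\in\mathbb{R}^{N\times2}$ be the matrix whose rows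 are the coordinates of all grid points (left block first, then right block), and let $\hat{\mathbf{S}}\in\mathbb{R}^{\hat N\times2}$ contain each distinct row of $\mathbf{S}$ exactly once ($\hat N$ is the number of distinct grid points). $E\in\mathbb{R}^{N\times\hat N}$ is the 0-1 matrix whose row $i$ has its single nonzero entry, equal to 1, in the column $j$ for which row $j$ of $\hat{\mathbf{S}}$ equals row $i$ of $\mathbf{S}$; thus $\mathbf{S}=E\hat{\mathbf{S}}$. Modified non-reduced Laplace operator: $$\tilde D_L^+=D_L^+-(H_\Omega^+)^{-1}\begin{bmatrix}e_e^{(l)\top}H_e^{(l)}d_e^{(l)}&e_e^{(l)\top}H_e^{(l)}d_w^{(r)}\\0&0\end{bmatrix}.$$ Physical boundary operators ($\partial\Omega_1$ the two north sides, $\partial\Omega_2$ the two south sides, $\partial\Omega_3$ the west side of the left block and the east side of the right block), with $\mathrm{diag}(A,B)$ denoting the block diagonal matrix: $e_{\partial\Omega_1}=\mathrm{diag}(e_n^{(l)},e_n^{(r)})E$, $d_{\partial\Omega_1}=\mathrm{diag}(d_n^{(l)},d_n^{(r)})E$, $H_{\partial\Omega_1}=\mathrm{diag}(H_n^{(l)},H_n^{(r)})$; $e_{\partial\Omega_2}=\mathrm{diag}(e_s^{(l)},e_s^{(r)})E$, $d_{\partial\Omega_2}=\mathrm{diag}(d_s^{(l)},d_s^{(r)})E$, $H_{\partial\Omega_2}=\mathrm{diag}(H_s^{(l)},H_s^{(r)})$; $e_{\partial\Omega_3}=\mathrm{diag}(e_w^{(l)},e_e^{(r)})E$, $d_{\partial\Omega_3}=\mathrm{diag}(d_w^{(l)},d_e^{(r)})E$,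 $H_{\partial\Omega_3}=\mathrm{diag}(H_w^{(l)},H_e^{(r)})$. *)

theory Defs
  imports Complex_Main "Jordan_Normal_Form.Gauss_Jordan_Elimination"
begin

section \<open>Matrix notation\<close>

definition kron :: "real mat \<Rightarrow> real mat \<Rightarrow> real mat" (infixl \<open>\<otimes>\<^sub>K\<close> 72) where
  "A \<otimes>\<^sub>K B = mat (dim_row A * dim_row B) (dim_col A * dim_col B)
     (\<lambda>(i, j). A $$ (i div dim_row B, j div dim_col B) * B $$ (i mod dim_row B, j mod dim_col B))"

(* The inverse is only meaningful for invertible arguments. *)
abbreviation minv :: "real mat \<Rightarrow> real mat" where
  "minv A \<equiv> the (mat_inverse A)"

definition vdiag :: "real vec \<Rightarrow> real mat" where
  "vdiag v = mat_diag (dim_vec v) (\<lambda>i. v $ i)"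

(* Entrywise square root; since sqrt 0 = 0, this is the matrix square root of a diagonal
   matrix with nonnegative entries, the only case in which it is used. *)
definition dsqrt :: "real mat \<Rightarrow> real mat" where
  "dsqrt A = map_mat sqrt A"

definition bdiag :: "real mat \<Rightarrow> real mat \<Rightarrow> real mat" where
  "bdiag A B = four_block_mat A (0\<^sub>m (dim_row A) (dim_col B)) (0\<^sub>m (dim_row B) (dim_col A)) B"

(* Used both for the inner products on the grid and for the boundary quadratures. *)
definition ip :: "real mat \<Rightarrow> real vec \<Rightarrow> real vec \<Rightarrow> real" where
  "ip M a b = a \<bullet> (M *\<^sub>v b)"

section \<open>One-dimensional operators\<close>

record sbp_ops =
  npts :: nat
  nodes :: "real vec"
  Hmat :: "real mat"
  D1 :: "real mat"

definition e_left :: "nat \<Rightarrow> real mat" where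
  "e_left m = mat_of_cols m [unit_vec m 0]"

definition e_right :: "nat \<Rightarrow> real mat" where
  "e_right m = mat_of_cols m [unit_vec m (m - 1)]"

definition is_sbp :: "sbp_ops \<Rightarrow> bool" where
  "is_sbp P \<longleftrightarrow> (let m = npts P; x = nodes P; H = Hmat P; D = D1 P in
     2 \<le> m \<and>
     x \<in> carrier_vec m \<and> x $ 0 = 0 \<and> x $ (m - 1) = 1 \<and>
     (\<forall>i j. i < j \<and> j < m \<longrightarrow> x $ i < x $ j) \<and>
     H \<in> carrier_mat m m \<and> diagonal_mat H \<and> (\<forall>i<m. 0 < H $$ (i, i)) \<and>
     D \<in> carrier_mat m m \<and>
     H * D + transpose_mat D * H =
       - (e_left m * transpose_mat (e_left m)) + e_right m * transpose_mat (e_right m))"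

section \<open>Two-dimensional reference operators\<close>

definition D_xi :: "sbp_ops \<Rightarrow> real mat" where
  "D_xi P = D1 P \<otimes>\<^sub>K 1\<^sub>m (npts P)"

definition D_eta :: "sbp_ops \<Rightarrow> real mat" where
  "D_eta P = 1\<^sub>m (npts P) \<otimes>\<^sub>K D1 P"

definition H_xi :: "sbp_ops \<Rightarrow> real mat" where
  "H_xi P = Hmat P \<otimes>\<^sub>K 1\<^sub>m (npts P)"

definition H_eta :: "sbp_ops \<Rightarrow> real mat" where
  "H_eta P = 1\<^sub>m (npts P) \<otimes>\<^sub>K Hmat P"

definition e_w :: "sbp_ops \<Rightarrow> real mat" where
  "e_w P = transpose_mat (e_left (npts P)) \<otimes>\<^sub>K 1\<^sub>m (npts P)"

definition e_e :: "sbp_ops \<Rightarrow> real mat" where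
  "e_e P = transpose_mat (e_right (npts P)) \<otimes>\<^sub>K 1\<^sub>m (npts P)"

definition e_s :: "sbp_ops \<Rightarrow> real mat" where
  "e_s P = 1\<^sub>m (npts P) \<otimes>\<^sub>K transpose_mat (e_left (npts P))"

definition e_n :: "sbp_ops \<Rightarrow> real mat" where
  "e_n P = 1\<^sub>m (npts P) \<otimes>\<^sub>K transpose_mat (e_right (npts P))"

definition D_xi_xi :: "sbp_ops \<Rightarrow> real mat \<Rightarrow> real mat" where
  "D_xi_xi P b = D_xi P * b * D_xi P"

definition D_eta_eta :: "sbp_ops \<Rightarrow> real mat \<Rightarrow> real mat" where
  "D_eta_eta P b = D_eta P * b * D_eta P"

section \<open>A single curvilinear block\<close>

(* A block is given by its parametrization (xi, eta) |-> (x, y) of the unit square; only the values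
   on the unit square are ever used. *)
type_synonym block = "real \<times> real \<Rightarrow> real \<times> real"

(* eta runs fastest: index k belongs to the node (xi_i, eta_j) with i = k div m, j = k mod m. *)
definition x_coords :: "sbp_ops \<Rightarrow> block \<Rightarrow> real vec" where
  "x_coords P F = vec (npts P * npts P)
     (\<lambda>k. fst (F (nodes P $ (k div npts P), nodes P $ (k mod npts P))))"

definition y_coords :: "sbp_ops \<Rightarrow> block \<Rightarrow> real vec" where
  "y_coords P F = vec (npts P * npts P)
     (\<lambda>k. snd (F (nodes P $ (k div npts P), nodes P $ (k mod npts P))))"

definition X_xi :: "sbp_ops \<Rightarrow> block \<Rightarrow> real mat" where
  "X_xi P F = vdiag (D_xi P *\<^sub>v x_coords P F)"

definition X_eta :: "sbp_ops \<Rightarrow> block \<Rightarrow> real mat" where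
  "X_eta P F = vdiag (D_eta P *\<^sub>v x_coords P F)"

definition Y_xi :: "sbp_ops \<Rightarrow> block \<Rightarrow> real mat" where
  "Y_xi P F = vdiag (D_xi P *\<^sub>v y_coords P F)"

definition Y_eta :: "sbp_ops \<Rightarrow> block \<Rightarrow> real mat" where
  "Y_eta P F = vdiag (D_eta P *\<^sub>v y_coords P F)"

definition Jac :: "sbp_ops \<Rightarrow> block \<Rightarrow> real mat" where
  "Jac P F = X_xi P F * Y_eta P F - X_eta P F * Y_xi P F"

definition alpha1 :: "sbp_ops \<Rightarrow> block \<Rightarrow> real mat" where
  "alpha1 P F = minv (Jac P F) * (X_eta P F * X_eta P F + Y_eta P F * Y_eta P F)"

definition beta :: "sbp_ops \<Rightarrow> block \<Rightarrow> real mat" where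
  "beta P F = - (minv (Jac P F) * (X_xi P F * X_eta P F + Y_xi P F * Y_eta P F))"

definition alpha2 :: "sbp_ops \<Rightarrow> block \<Rightarrow> real mat" where
  "alpha2 P F = minv (Jac P F) * (X_xi P F * X_xi P F + Y_xi P F * Y_xi P F)"

definition W1 :: "sbp_ops \<Rightarrow> block \<Rightarrow> real mat" where
  "W1 P F = dsqrt (X_xi P F * X_xi P F + Y_xi P F * Y_xi P F)"

definition W2 :: "sbp_ops \<Rightarrow> block \<Rightarrow> real mat" where
  "W2 P F = dsqrt (X_eta P F * X_eta P F + Y_eta P F * Y_eta P F)"

definition block_Lap :: "sbp_ops \<Rightarrow> block \<Rightarrow> real mat" where
  "block_Lap P F = minv (Jac P F) *
     (D_xi_xi P (alpha1 P F) + D_eta P * beta P F * D_xi P + D_xi P * beta P F * D_eta P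
      + D_eta_eta P (alpha2 P F))"

definition D_x :: "sbp_ops \<Rightarrow> block \<Rightarrow> real mat" where
  "D_x P F = minv (Jac P F) * (Y_eta P F * D_xi P - Y_xi P F * D_eta P)"

definition D_y :: "sbp_ops \<Rightarrow> block \<Rightarrow> real mat" where
  "D_y P F = minv (Jac P F) * (- (X_eta P F * D_xi P) + X_xi P F * D_eta P)"

definition block_H :: "sbp_ops \<Rightarrow> block \<Rightarrow> real mat" where
  "block_H P F = H_xi P * H_eta P * Jac P F"

definition H_w :: "sbp_ops \<Rightarrow> block \<Rightarrow> real mat" where
  "H_w P F = Hmat P * e_w P * W2 P F * transpose_mat (e_w P)"

definition H_e :: "sbp_ops \<Rightarrow> block \<Rightarrow> real mat" where
  "H_e P F = Hmat P * e_e P * W2 P F * transpose_mat (e_e P)"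

definition H_s :: "sbp_ops \<Rightarrow> block \<Rightarrow> real mat" where
  "H_s P F = Hmat P * e_s P * W1 P F * transpose_mat (e_s P)"

definition H_n :: "sbp_ops \<Rightarrow> block \<Rightarrow> real mat" where
  "H_n P F = Hmat P * e_n P * W1 P F * transpose_mat (e_n P)"

definition n1_w :: "sbp_ops \<Rightarrow> block \<Rightarrow> real mat" where
  "n1_w P F = - (e_w P * minv (W2 P F) * Y_eta P F * transpose_mat (e_w P))"

definition n2_w :: "sbp_ops \<Rightarrow> block \<Rightarrow> real mat" where
  "n2_w P F = e_w P * minv (W2 P F) * X_eta P F * transpose_mat (e_w P)"

definition n1_e :: "sbp_ops \<Rightarrow> block \<Rightarrow> real mat" where
  "n1_e P F = e_e P * minv (W2 P F) * Y_eta P F * transpose_mat (e_e P)"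

definition n2_e :: "sbp_ops \<Rightarrow> block \<Rightarrow> real mat" where
  "n2_e P F = - (e_e P * minv (W2 P F) * X_eta P F * transpose_mat (e_e P))"

definition n1_s :: "sbp_ops \<Rightarrow> block \<Rightarrow> real mat" where
  "n1_s P F = e_s P * minv (W1 P F) * Y_xi P F * transpose_mat (e_s P)"

definition n2_s :: "sbp_ops \<Rightarrow> block \<Rightarrow> real mat" where
  "n2_s P F = - (e_s P * minv (W1 P F) * X_xi P F * transpose_mat (e_s P))"

definition n1_n :: "sbp_ops \<Rightarrow> block \<Rightarrow> real mat" where
  "n1_n P F = - (e_n P * minv (W1 P F) * Y_xi P F * transpose_mat (e_n P))"

definition n2_n :: "sbp_ops \<Rightarrow> block \<Rightarrow> real mat" where
  "n2_n P F = e_n P * minv (W1 P F) * X_xi P F * transpose_mat (e_n P)"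

definition d_w :: "sbp_ops \<Rightarrow> block \<Rightarrow> real mat" where
  "d_w P F = n1_w P F * e_w P * D_x P F + n2_w P F * e_w P * D_y P F"

definition d_e :: "sbp_ops \<Rightarrow> block \<Rightarrow> real mat" where
  "d_e P F = n1_e P F * e_e P * D_x P F + n2_e P F * e_e P * D_y P F"

definition d_s :: "sbp_ops \<Rightarrow> block \<Rightarrow> real mat" where
  "d_s P F = n1_s P F * e_s P * D_x P F + n2_s P F * e_s P * D_y P F"

definition d_n :: "sbp_ops \<Rightarrow> block \<Rightarrow> real mat" where
  "d_n P F = n1_n P F * e_n P * D_x P F + n2_n P F * e_n P * D_y P F"

definition positive_Jacobian :: "sbp_ops \<Rightarrow> block \<Rightarrow> bool" where
  "positive_Jacobian P F \<longleftrightarrow> (\<forall>k < npts P * npts P. 0 < Jac P F $$ (k, k))"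

section \<open>The two-block domain\<close>

definition grid_points :: "sbp_ops \<Rightarrow> block \<Rightarrow> block \<Rightarrow> real mat" where
  "grid_points P Fl Fr = mat_of_cols (2 * (npts P * npts P))
     [x_coords P Fl @\<^sub>v x_coords P Fr, y_coords P Fl @\<^sub>v y_coords P Fr]"

(* In the last clause, row (m - 1) * m + k is the k-th east point of the left block and row
   m * m + k the k-th west point of the right block. *)
definition two_block_domain :: "sbp_ops \<Rightarrow> block \<Rightarrow> block \<Rightarrow> bool" where
  "two_block_domain P Fl Fr \<longleftrightarrow> (let m = npts P; S = grid_points P Fl Fr in
     positive_Jacobian P Fl \<and> positive_Jacobian P Fr \<and>
     Fl ` ({1} \<times> {0..1}) = Fr ` ({0} \<times> {0..1}) \<and>
     e_e P *\<^sub>v x_coords P Fl = e_w P *\<^sub>v x_coords P Fr \<and>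
     e_e P *\<^sub>v y_coords P Fl = e_w P *\<^sub>v y_coords P Fr \<and>
     (\<forall>i j. i < j \<and> j < dim_row S \<and> row S i = row S j \<longrightarrow>
        (\<exists>k<m. i = (m - 1) * m + k \<and> j = m * m + k)))"

definition distinct_points_of :: "real mat \<Rightarrow> real mat \<Rightarrow> bool" where
  "distinct_points_of S S' \<longleftrightarrow>
     dim_col S' = dim_col S \<and> distinct (rows S') \<and> set (rows S') = set (rows S)"

definition embedding :: "real mat \<Rightarrow> real mat \<Rightarrow> real mat" where
  "embedding S S' = mat (dim_row S) (dim_row S') (\<lambda>(i, j). if row S' j = row S i then 1 else 0)"

definition H_plus :: "sbp_ops \<Rightarrow> block \<Rightarrow> block \<Rightarrow> real mat" where
  "H_plus P Fl Fr = bdiag (block_H P Fl) (block_H P Fr)"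

definition Lap_plus :: "sbp_ops \<Rightarrow> block \<Rightarrow> block \<Rightarrow> real mat" where
  "Lap_plus P Fl Fr = bdiag (block_Lap P Fl) (block_Lap P Fr)"

definition Dx_plus :: "sbp_ops \<Rightarrow> block \<Rightarrow> block \<Rightarrow> real mat" where
  "Dx_plus P Fl Fr = bdiag (D_x P Fl) (D_x P Fr)"

definition Dy_plus :: "sbp_ops \<Rightarrow> block \<Rightarrow> block \<Rightarrow> real mat" where
  "Dy_plus P Fl Fr = bdiag (D_y P Fl) (D_y P Fr)"

definition Lap_tilde_plus :: "sbp_ops \<Rightarrow> block \<Rightarrow> block \<Rightarrow> real mat" where
  "Lap_tilde_plus P Fl Fr = (let n = npts P * npts P in
     Lap_plus P Fl Fr - minv (H_plus P Fl Fr) *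
       four_block_mat (transpose_mat (e_e P) * H_e P Fl * d_e P Fl)
                      (transpose_mat (e_e P) * H_e P Fl * d_w P Fr)
                      (0\<^sub>m n n) (0\<^sub>m n n))"

definition H_red :: "sbp_ops \<Rightarrow> block \<Rightarrow> block \<Rightarrow> real mat \<Rightarrow> real mat" where
  "H_red P Fl Fr E = transpose_mat E * H_plus P Fl Fr * E"

definition Lap_red :: "sbp_ops \<Rightarrow> block \<Rightarrow> block \<Rightarrow> real mat \<Rightarrow> real mat" where
  "Lap_red P Fl Fr E =
     minv (H_red P Fl Fr E) * transpose_mat E * H_plus P Fl Fr * Lap_tilde_plus P Fl Fr * E"

(* Physical boundary parts: 1 = the two north sides, 2 = the two south sides,
   3 = west side of the left block and east side of the right block. *)

definition e_bd1 :: "sbp_ops \<Rightarrow> real mat \<Rightarrow> real mat" where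
  "e_bd1 P E = bdiag (e_n P) (e_n P) * E"

definition d_bd1 :: "sbp_ops \<Rightarrow> block \<Rightarrow> block \<Rightarrow> real mat \<Rightarrow> real mat" where
  "d_bd1 P Fl Fr E = bdiag (d_n P Fl) (d_n P Fr) * E"

definition H_bd1 :: "sbp_ops \<Rightarrow> block \<Rightarrow> block \<Rightarrow> real mat" where
  "H_bd1 P Fl Fr = bdiag (H_n P Fl) (H_n P Fr)"

definition e_bd2 :: "sbp_ops \<Rightarrow> real mat \<Rightarrow> real mat" where
  "e_bd2 P E = bdiag (e_s P) (e_s P) * E"

definition d_bd2 :: "sbp_ops \<Rightarrow> block \<Rightarrow> block \<Rightarrow> real mat \<Rightarrow> real mat" where
  "d_bd2 P Fl Fr E = bdiag (d_s P Fl) (d_s P Fr) * E"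

definition H_bd2 :: "sbp_ops \<Rightarrow> block \<Rightarrow> block \<Rightarrow> real mat" where
  "H_bd2 P Fl Fr = bdiag (H_s P Fl) (H_s P Fr)"

definition e_bd3 :: "sbp_ops \<Rightarrow> real mat \<Rightarrow> real mat" where
  "e_bd3 P E = bdiag (e_w P) (e_e P) * E"

definition d_bd3 :: "sbp_ops \<Rightarrow> block \<Rightarrow> block \<Rightarrow> real mat \<Rightarrow> real mat" where
  "d_bd3 P Fl Fr E = bdiag (d_w P Fl) (d_e P Fr) * E"

definition H_bd3 :: "sbp_ops \<Rightarrow> block \<Rightarrow> block \<Rightarrow> real mat" where
  "H_bd3 P Fl Fr = bdiag (H_w P Fl) (H_e P Fr)"

definition boundary_terms ::
  "sbp_ops \<Rightarrow> block \<Rightarrow> block \<Rightarrow> real mat \<Rightarrow> real vec \<Rightarrow> real vec \<Rightarrow> real" where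
  "boundary_terms P Fl Fr E u v =
     ip (H_bd1 P Fl Fr) (e_bd1 P E *\<^sub>v u) (d_bd1 P Fl Fr E *\<^sub>v v)
   + ip (H_bd2 P Fl Fr) (e_bd2 P E *\<^sub>v u) (d_bd2 P Fl Fr E *\<^sub>v v)
   + ip (H_bd3 P Fl Fr) (e_bd3 P E *\<^sub>v u) (d_bd3 P Fl Fr E *\<^sub>v v)"

end

(* On one block the reference operators D_xi and D_eta satisfy summation by parts, and the
   metric coefficients in the Laplacian are such that the contravariant fluxes paired with the
   reference derivatives reproduce the physical gradient, while the fluxes on the four sides are
   the normal derivatives weighted by arc length. This gives the identity on each block, with
   boundary terms on all four sides. The correction in the modified Laplacian removes the east term
   of the left block exactly; it also removes the west term of the right block, because an embedded
   vector takes the same values on both sides of the interface and the two interface quadratures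
   agree. Multiplying by H_Omega cancels the inverse in the reduced operator. *)

theory Submission
  imports Defs
begin

section \<open>Diagonal matrices and their inverses\<close>

text \<open>Every matrix to be inverted turns out to be diagonal: the Jacobian, the arc-length
  factors, \<open>H_plus\<close> and, because each row of the embedding has a single 1, also
  \<open>H_red\<close>. Since \<open>minv\<close> is unspecified on singular arguments, each inverse
  must be earned by positivity: a positive Jacobian keeps both tangent vectors from vanishing, and
  each diagonal entry of \<open>H_red\<close> is a nonempty sum of positive weights. The obstacle on
  a curved block is that the metric coefficients vary from point to point while the discrete
  derivative obeys no product rule. The argument therefore never differentiates a product. The
  Laplacian is read in divergence form, its outer derivatives act on whole flux vectors, and
  summation by parts moves them onto \<open>u\<close>. What remains is algebra at each grid point.
  It is exact because the Laplacian, the gradient, the normals and the quadratures all use the same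
  discrete metric.\<close>

lemma minv_eqI:
  assumes "A \<in> carrier_mat n n" "B \<in> carrier_mat n n" "A * B = 1\<^sub>m n" "B * A = 1\<^sub>m n"
  shows "minv A = B"
proof (cases "mat_inverse A")
  \<comment> \<open>\<open>the None\<close> is unspecified, so this case has to be excluded: the
    two-sided inverse \<open>B\<close> makes \<open>A\<close> a unit of the matrix ring.\<close>
  case None
  have "A \<in> Units (ring_mat TYPE(real) n ())"
    using assms by (auto simp: Units_def ring_mat_def)
  moreover have "A \<notin> Units (ring_mat TYPE(real) n ())"
    by (rule mat_inverse(1)[OF assms(1) None])
  ultimately show ?thesis by blast
next
  case (Some C)
  from mat_inverse(2)[OF assms(1) this]
  have C: "C * A = 1\<^sub>m n" "C \<in> carrier_mat n n" by auto
  have "C = C * (A * B)" using assms(3) C(2) by simp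
  also have "\<dots> = (C * A) * B" using assms(1,2) C(2) by simp
  also have "\<dots> = B" using C(1) assms(2) by simp
  finally show ?thesis using Some by simp
qed

lemma minv_mat_diag:
  assumes "\<And>i. i < n \<Longrightarrow> f i \<noteq> 0"
  shows "minv (mat_diag n f) = mat_diag n (\<lambda>i. inverse (f i))"
proof (rule minv_eqI[of _ n])
  have "mat_diag n (\<lambda>i. f i * inverse (f i)) = 1\<^sub>m n"
       "mat_diag n (\<lambda>i. inverse (f i) * f i) = 1\<^sub>m n"
    using assms by (auto simp: mat_diag_def one_mat_def)
  then show "mat_diag n f * mat_diag n (\<lambda>i. inverse (f i)) = 1\<^sub>m n"
       "mat_diag n (\<lambda>i. inverse (f i)) * mat_diag n f = 1\<^sub>m n" by simp_all
qed simp_all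

lemma mat_diag_cong: "(\<And>i. i < n \<Longrightarrow> f i = g i) \<Longrightarrow> mat_diag n f = mat_diag n g"
  by (auto simp: mat_diag_def)

lemma dim_mat_diag [simp]: "dim_row (mat_diag n f) = n" "dim_col (mat_diag n f) = n"
  by (simp_all add: mat_diag_def)

lemma mat_diag_mult_vec:
  fixes f :: "nat \<Rightarrow> real"
  assumes "v \<in> carrier_vec n"
  shows "mat_diag n f *\<^sub>v v = vec n (\<lambda>i. f i * v $ i)"
proof (rule eq_vecI)
  fix i assume i: "i < dim_vec (vec n (\<lambda>i. f i * v $ i))"
  have "(mat_diag n f *\<^sub>v v) $ i = (\<Sum>j\<in>{0..<n}. (if i = j then f j else 0) * v $ j)"
    using i assms by (auto simp: mat_diag_def scalar_prod_def)
  also have "\<dots> = (\<Sum>j\<in>{0..<n}. if i = j then f j * v $ j else 0)"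
    by (rule sum.cong) auto
  also have "\<dots> = f i * v $ i" using i by simp
  finally show "(mat_diag n f *\<^sub>v v) $ i = vec n (\<lambda>i. f i * v $ i) $ i" using i by simp
qed simp

lemma mat_diag_add: "mat_diag n f + mat_diag n g = mat_diag n (\<lambda>i. f i + g i :: real)"
  and mat_diag_minus: "mat_diag n f - mat_diag n g = mat_diag n (\<lambda>i. f i - g i)"
  and mat_diag_uminus: "- mat_diag n f = mat_diag n (\<lambda>i. - f i)"
  by (auto simp: mat_diag_def)

lemma dsqrt_mat_diag: "dsqrt (mat_diag n f) = mat_diag n (\<lambda>i. sqrt (f i))"
  by (auto simp: dsqrt_def mat_diag_def)

lemma diagonal_mat_eq_mat_diag:
  "A \<in> carrier_mat n n \<Longrightarrow> diagonal_mat A \<Longrightarrow> A = mat_diag n (\<lambda>i. A $$ (i, i))"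
  by (auto simp: mat_diag_def diagonal_mat_def)

lemma ip_mat_diag:
  assumes "b \<in> carrier_vec n"
  shows "ip (mat_diag n f) a b = (\<Sum>i<n. f i * a $ i * b $ i)"
  using assms by (simp add: ip_def mat_diag_mult_vec scalar_prod_def mult.assoc mult.left_commute atLeast0LessThan)

section \<open>Selection matrices\<close>

text \<open>Common form of the four side restrictions and of the embedding. Applying such a matrix
  is reindexing by \<open>s\<close>, which turns matrix identities into identities between
  sums.\<close>

definition selection :: "nat \<Rightarrow> nat \<Rightarrow> (nat \<Rightarrow> nat) \<Rightarrow> real mat" where
  "selection m n s = mat m n (\<lambda>(j, k). if k = s j then 1 else 0)"

lemma selection_carrier [simp]: "selection m n s \<in> carrier_mat m n"
  and dim_selection [simp]: "dim_row (selection m n s) = m" "dim_col (selection m n s) = n"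
  by (simp_all add: selection_def)

lemma selection_mult_vec:
  assumes "\<And>j. j < m \<Longrightarrow> s j < n" "v \<in> carrier_vec n"
  shows "selection m n s *\<^sub>v v = vec m (\<lambda>j. v $ s j)"
proof (rule eq_vecI)
  fix j assume "j < dim_vec (vec m (\<lambda>j. v $ s j))"
  then have j: "j < m" by simp
  have "(selection m n s *\<^sub>v v) $ j = (\<Sum>k\<in>{0..<n}. (if k = s j then 1 else 0) * v $ k)"
    using j assms by (auto simp: selection_def scalar_prod_def)
  also have "\<dots> = (\<Sum>k\<in>{0..<n}. if k = s j then v $ k else 0)"
    by (rule sum.cong) auto
  also have "\<dots> = v $ s j" using assms(1)[OF j] by simp
  finally show "(selection m n s *\<^sub>v v) $ j = vec m (\<lambda>j. v $ s j) $ j" using j by simp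
qed simp

text \<open>Rows \<open>i\<close> and \<open>j\<close> share a column only if
  \<open>s i = s j\<close>, which injectivity excludes off the diagonal. This evaluates the boundary
  quadratures and the normals.\<close>

lemma selection_diag_conj:
  assumes "\<And>j. j < m \<Longrightarrow> s j < n" "inj_on s {..<m}"
  shows "selection m n s * mat_diag n f * transpose_mat (selection m n s) = mat_diag m (\<lambda>j. f (s j))"
proof (rule eq_matI)
  fix i j assume "i < dim_row (mat_diag m (\<lambda>j. f (s j)))" "j < dim_col (mat_diag m (\<lambda>j. f (s j)))"
  then have ij: "i < m" "j < m" by auto
  have "(selection m n s * mat_diag n f * transpose_mat (selection m n s)) $$ (i, j)
      = (\<Sum>k\<in>{0..<n}. ((if k = s i then 1 else 0) * f k) * (if k = s j then 1 else 0))"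
    using ij by (auto simp: mat_diag_mult_right[of _ m n] selection_def scalar_prod_def)
  also have "\<dots> = (\<Sum>k\<in>{0..<n}. if k = s i then (if i = j then f k else 0) else 0)"
    using ij inj_onD[OF assms(2), of i j] by (intro sum.cong) auto
  also have "\<dots> = (if i = j then f (s i) else 0)" using assms(1)[OF ij(1)] by simp
  finally show "(selection m n s * mat_diag n f * transpose_mat (selection m n s)) $$ (i, j)
      = mat_diag m (\<lambda>j. f (s j)) $$ (i, j)"
    using ij by (simp add: mat_diag_def)
qed auto

text \<open>Here \<open>s\<close> may identify indices, as the embedding does on the interface; the
  weights of identified points then add up.\<close>

lemma selection_diag_conj_transpose:
  "transpose_mat (selection m n s) * mat_diag m f * selection m n s
   = mat_diag n (\<lambda>k. \<Sum>i | i < m \<and> s i = k. f i)"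
proof (rule eq_matI)
  fix k l assume "k < dim_row (mat_diag n (\<lambda>k. \<Sum>i | i < m \<and> s i = k. f i))"
    "l < dim_col (mat_diag n (\<lambda>k. \<Sum>i | i < m \<and> s i = k. f i))"
  then have kl: "k < n" "l < n" by auto
  have "(transpose_mat (selection m n s) * mat_diag m f * selection m n s) $$ (k, l)
      = (\<Sum>i\<in>{0..<m}. ((if k = s i then 1 else 0) * f i) * (if l = s i then 1 else 0))"
    using kl by (auto simp: mat_diag_mult_right[of _ n m] selection_def scalar_prod_def)
  also have "\<dots> = (\<Sum>i\<in>{0..<m}. if s i = k then (if k = l then f i else 0) else 0)"
    by (intro sum.cong) auto
  also have "\<dots> = (\<Sum>i | i < m \<and> s i = k. if k = l then f i else 0)"
    by (simp add: sum.inter_filter[symmetric])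
  also have "\<dots> = mat_diag n (\<lambda>k. \<Sum>i | i < m \<and> s i = k. f i) $$ (k, l)"
    using kl by (simp add: mat_diag_def)
  finally show "(transpose_mat (selection m n s) * mat_diag m f * selection m n s) $$ (k, l)
      = mat_diag n (\<lambda>k. \<Sum>i | i < m \<and> s i = k. f i) $$ (k, l)" .
qed auto

section \<open>Kronecker products with an identity\<close>

lemma dim_kron [simp]: "dim_row (A \<otimes>\<^sub>K B) = dim_row A * dim_row B"
  "dim_col (A \<otimes>\<^sub>K B) = dim_col A * dim_col B"
  by (simp_all add: kron_def)

lemma sum_nat_product:
  fixes g :: "nat \<Rightarrow> 'a::comm_monoid_add"
  shows "(\<Sum>k<a * b. g k) = (\<Sum>i<a. \<Sum>j<b. g (i * b + j))"
proof -
  have "(\<Sum>k<a * b. g k) = (\<Sum>i<a. sum g {i * b..<i * b + b})"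
    by (rule sum.nat_group[symmetric])
  also have "\<dots> = (\<Sum>i<a. \<Sum>j<b. g (i * b + j))"
  proof (rule sum.cong[OF refl])
    fix i
    show "sum g {i * b..<i * b + b} = (\<Sum>j<b. g (i * b + j))"
      using sum.shift_bounds_nat_ivl[of g 0 "i * b" b]
      by (simp add: atLeast0LessThan add.commute)
  qed
  finally show ?thesis .
qed

lemma pair_index_less: "i < a \<Longrightarrow> j < b \<Longrightarrow> i * b + j < a * (b::nat)"
  using mult_le_mono1[of "Suc i" a b] by simp

lemma pair_index_iff: "j < b \<Longrightarrow> k div b = i \<and> k mod b = j \<longleftrightarrow> k = i * b + (j::nat)"
  by (auto simp: mult.commute[of _ b])

text \<open>The identity factor couples only entries with the same fast index \<open>j\<close>, so
  \<open>A\<close> acts on the slow index, along lines of constant \<open>eta\<close>.\<close>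

lemma kron_one_right_mult_vec:
  assumes A: "A \<in> carrier_mat r c" and v: "v \<in> carrier_vec (c * m)" and ij: "i < r" "j < m"
  shows "((A \<otimes>\<^sub>K 1\<^sub>m m) *\<^sub>v v) $ (i * m + j) = (\<Sum>k<c. A $$ (i, k) * v $ (k * m + j))"
proof -
  have ijr: "i * m + j < r * m" using ij by (rule pair_index_less)
  have "((A \<otimes>\<^sub>K 1\<^sub>m m) *\<^sub>v v) $ (i * m + j)
      = (\<Sum>k<c * m. (A \<otimes>\<^sub>K 1\<^sub>m m) $$ (i * m + j, k) * v $ k)"
    using A v ijr by (simp add: scalar_prod_def atLeast0LessThan row_def)
  also have "\<dots> = (\<Sum>k<c. \<Sum>l<m. (A \<otimes>\<^sub>K 1\<^sub>m m) $$ (i * m + j, k * m + l) * v $ (k * m + l))"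
    by (rule sum_nat_product)
  also have "\<dots> = (\<Sum>k<c. \<Sum>l<m. if l = j then A $$ (i, k) * v $ (k * m + l) else 0)"
  proof (intro sum.cong[OF refl])
    fix k l assume "k \<in> {..<c}" "l \<in> {..<m}"
    then show "(A \<otimes>\<^sub>K 1\<^sub>m m) $$ (i * m + j, k * m + l) * v $ (k * m + l)
        = (if l = j then A $$ (i, k) * v $ (k * m + l) else 0)"
      using A ij ijr pair_index_less[of k c l m] by (auto simp: kron_def)
  qed
  also have "\<dots> = (\<Sum>k<c. A $$ (i, k) * v $ (k * m + j))" using ij by simp
  finally show ?thesis .
qed

lemma kron_one_left_mult_vec:
  assumes A: "A \<in> carrier_mat r c" and v: "v \<in> carrier_vec (m * c)" and ij: "i < m" "j < r"
  shows "((1\<^sub>m m \<otimes>\<^sub>K A) *\<^sub>v v) $ (i * r + j) = (\<Sum>k<c. A $$ (j, k) * v $ (i * c + k))"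
proof -
  have ijr: "i * r + j < m * r" using ij by (rule pair_index_less)
  have "((1\<^sub>m m \<otimes>\<^sub>K A) *\<^sub>v v) $ (i * r + j)
      = (\<Sum>k<m * c. (1\<^sub>m m \<otimes>\<^sub>K A) $$ (i * r + j, k) * v $ k)"
    using A v ijr by (simp add: scalar_prod_def atLeast0LessThan row_def)
  also have "\<dots> = (\<Sum>k<m. \<Sum>l<c. (1\<^sub>m m \<otimes>\<^sub>K A) $$ (i * r + j, k * c + l) * v $ (k * c + l))"
    by (rule sum_nat_product)
  also have "\<dots> = (\<Sum>k<m. if k = i then (\<Sum>l<c. A $$ (j, l) * v $ (k * c + l)) else 0)"
  proof (intro sum.cong[OF refl])
    fix k assume k: "k \<in> {..<m}"
    have "(\<Sum>l<c. (1\<^sub>m m \<otimes>\<^sub>K A) $$ (i * r + j, k * c + l) * v $ (k * c + l))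
      = (\<Sum>l<c. if k = i then A $$ (j, l) * v $ (k * c + l) else 0)"
    proof (intro sum.cong[OF refl])
      fix l assume "l \<in> {..<c}"
      then show "(1\<^sub>m m \<otimes>\<^sub>K A) $$ (i * r + j, k * c + l) * v $ (k * c + l)
          = (if k = i then A $$ (j, l) * v $ (k * c + l) else 0)"
        using A k ij ijr pair_index_less[of k m l c] by (auto simp: kron_def)
    qed
    then show "(\<Sum>l<c. (1\<^sub>m m \<otimes>\<^sub>K A) $$ (i * r + j, k * c + l) * v $ (k * c + l))
      = (if k = i then (\<Sum>l<c. A $$ (j, l) * v $ (k * c + l)) else 0)" by simp
  qed
  also have "\<dots> = (\<Sum>l<c. A $$ (j, l) * v $ (i * c + l))" using ij by simp
  finally show ?thesis .
qed

lemma kron_mat_diag: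
  assumes "0 < m"
  shows "mat_diag n f \<otimes>\<^sub>K mat_diag m g = mat_diag (n * m) (\<lambda>k. f (k div m) * g (k mod m))"
proof (rule eq_matI)
  fix i j assume "i < dim_row (mat_diag (n * m) (\<lambda>k. f (k div m) * g (k mod m)))"
    "j < dim_col (mat_diag (n * m) (\<lambda>k. f (k div m) * g (k mod m)))"
  then have ij: "i < n * m" "j < n * m" by auto
  have "i = j \<longleftrightarrow> i div m = j div m \<and> i mod m = j mod m"
    by (metis div_mult_mod_eq)
  then show "(mat_diag n f \<otimes>\<^sub>K mat_diag m g) $$ (i, j)
      = mat_diag (n * m) (\<lambda>k. f (k div m) * g (k mod m)) $$ (i, j)"
    using ij assms by (auto simp: kron_def mat_diag_def less_mult_imp_div_less)
qed auto

text \<open>Keeps entries such as \<open>(D_xi P *\<^sub>v v) $ k\<close> opaque from here on;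
  otherwise simplification would expand them into scalar products with matrix rows.\<close>

declare index_mult_mat_vec [simp del]

section \<open>Summation by parts on the reference square\<close>

locale sbp_operators =
  fixes P :: sbp_ops
  assumes is_sbp: "is_sbp P"
begin

abbreviation "m \<equiv> npts P"
abbreviation "n \<equiv> npts P * npts P"

definition h :: "nat \<Rightarrow> real" where "h i = Hmat P $$ (i, i)"
definition w :: "nat \<Rightarrow> real" where "w k = h (k div m) * h (k mod m)"

text \<open>Flat indices on the sides follow the ordering with \<open>eta\<close> fastest.
  \<open>west\<close> is the identity, but has a name so that all four sides fit the same
  \<open>selection\<close> pattern.\<close>

definition east :: "nat \<Rightarrow> nat" where "east j = (m - 1) * m + j"
definition west :: "nat \<Rightarrow> nat" where "west j = j"
definition south :: "nat \<Rightarrow> nat" where "south i = i * m"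
definition north :: "nat \<Rightarrow> nat" where "north i = i * m + (m - 1)"

lemma npts_ge: "2 \<le> m" and Hmat_carrier: "Hmat P \<in> carrier_mat m m"
  and Hmat_diagonal: "diagonal_mat (Hmat P)" and D1_carrier: "D1 P \<in> carrier_mat m m"
  and h_pos: "i < m \<Longrightarrow> 0 < h i"
  and sbp_mat: "Hmat P * D1 P + transpose_mat (D1 P) * Hmat P =
     - (e_left m * transpose_mat (e_left m)) + e_right m * transpose_mat (e_right m)"
  using is_sbp by (auto simp: is_sbp_def Let_def h_def)

lemma Hmat_eq: "Hmat P = mat_diag m h"
  unfolding h_def[abs_def] using Hmat_carrier Hmat_diagonal by (rule diagonal_mat_eq_mat_diag)

lemma e_left_eq: "e_left m = mat m 1 (\<lambda>(i, j). if i = 0 then 1 else 0)"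
  by (auto simp: e_left_def mat_of_cols_def unit_vec_def)

lemma e_right_eq: "e_right m = mat m 1 (\<lambda>(i, j). if i = m - 1 then 1 else 0)"
  by (auto simp: e_right_def mat_of_cols_def unit_vec_def)

lemma sbp_entry:
  assumes ij: "i < m" "j < m"
  shows "h i * D1 P $$ (i, j) + D1 P $$ (j, i) * h j
     = (if i = m - 1 \<and> j = m - 1 then 1 else 0) - (if i = 0 \<and> j = 0 then 1 else 0)"
proof -
  have "(Hmat P * D1 P + transpose_mat (D1 P) * Hmat P) $$ (i, j)
      = h i * D1 P $$ (i, j) + D1 P $$ (j, i) * h j"
    using ij D1_carrier unfolding Hmat_eq
    by (simp add: mat_diag_mult_left[of _ m m] mat_diag_mult_right[of _ m m])
  moreover have "(- (e_left m * transpose_mat (e_left m)) + e_right m * transpose_mat (e_right m)) $$ (i, j)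
      = (if i = m - 1 \<and> j = m - 1 then 1 else 0) - (if i = 0 \<and> j = 0 then 1 else 0)"
    using ij by (auto simp: e_left_eq e_right_eq scalar_prod_def)
  ultimately show ?thesis by (simp only: sbp_mat)
qed

text \<open>The left side is the bilinear form of
  \<open>Hmat P * D1 P + transpose_mat (D1 P) * Hmat P\<close>. It is stated for functions so that
  the values on any single grid line can be inserted.\<close>

lemma sbp_1d:
  "(\<Sum>i<m. h i * a i * (\<Sum>k<m. D1 P $$ (i, k) * b k)) + (\<Sum>i<m. h i * (\<Sum>k<m. D1 P $$ (i, k) * a k) * b i)
   = a (m - 1) * b (m - 1) - a 0 * b 0"
proof -
  have m0: "0 < m" using npts_ge by simp
  have "(\<Sum>i<m. h i * (\<Sum>k<m. D1 P $$ (i, k) * a k) * b i)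
      = (\<Sum>i<m. \<Sum>k<m. a k * b i * (D1 P $$ (i, k) * h i))"
    by (simp add: sum_distrib_left sum_distrib_right ac_simps)
  \<comment> \<open>Exchanging the sums also exchanges the names of the indices, so that both sums
    carry the common factor \<open>a i * b k\<close>.\<close>
  also have "\<dots> = (\<Sum>i<m. \<Sum>k<m. a i * b k * (D1 P $$ (k, i) * h k))"
    by (rule sum.swap)
  finally have "(\<Sum>i<m. h i * a i * (\<Sum>k<m. D1 P $$ (i, k) * b k)) + (\<Sum>i<m. h i * (\<Sum>k<m. D1 P $$ (i, k) * a k) * b i)
      = (\<Sum>i<m. \<Sum>k<m. a i * b k * (h i * D1 P $$ (i, k) + D1 P $$ (k, i) * h k))"
    by (simp add: sum_distrib_left sum.distrib[symmetric] algebra_simps)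
  also have "\<dots> = (\<Sum>i<m. \<Sum>k<m. a i * b k
      * ((if i = m - 1 \<and> k = m - 1 then 1 else 0) - (if i = 0 \<and> k = 0 then 1 else 0)))"
    by (intro sum.cong[OF refl]) (simp add: sbp_entry)
  \<comment> \<open>Nesting the conditionals lets the inner and then the outer sum collapse to a
    single corner term.\<close>
  also have "\<dots> = (\<Sum>i<m. \<Sum>k<m. (if k = m - 1 then (if i = m - 1 then a i * b k else 0) else 0)
       - (if k = 0 then (if i = 0 then a i * b k else 0) else 0))"
    by (intro sum.cong[OF refl]) auto
  also have "\<dots> = a (m - 1) * b (m - 1) - a 0 * b 0"
    using m0 by (simp add: sum_subtractf)
  finally show ?thesis .
qed

section \<open>Summation by parts along the grid lines of the square\<close>

lemma D_xi_carrier [simp]: "D_xi P \<in> carrier_mat n n"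
  and D_eta_carrier [simp]: "D_eta P \<in> carrier_mat n n"
  using D1_carrier by (auto simp: D_xi_def D_eta_def)

lemma dim_D_xi_eta [simp]: "dim_row (D_xi P) = n" "dim_col (D_xi P) = n"
    "dim_row (D_eta P) = n" "dim_col (D_eta P) = n"
  by (rule carrier_matD[OF D_xi_carrier] carrier_matD[OF D_eta_carrier])+

lemma D_xi_eta_vec_carrier [simp]: "D_xi P *\<^sub>v v \<in> carrier_vec n" "D_eta P *\<^sub>v v \<in> carrier_vec n"
  by (rule carrier_vecI, simp)+

lemma HH_eq: "H_xi P * H_eta P = mat_diag n w"
proof -
  have "0 < m" using npts_ge by simp
  then show ?thesis
    unfolding H_xi_def H_eta_def Hmat_eq mat_diag_one[symmetric] w_def[abs_def]
    by (simp add: kron_mat_diag del: mat_diag_one)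
qed

lemma w_pos: "k < n \<Longrightarrow> 0 < w k"
  using npts_ge by (simp add: w_def h_pos less_mult_imp_div_less)

lemma sum_w: "(\<Sum>k<n. w k * f k) = (\<Sum>i<m. \<Sum>j<m. h i * h j * f (i * m + j))"
  by (simp add: sum_nat_product w_def)

lemma D_xi_index:
  "v \<in> carrier_vec n \<Longrightarrow> i < m \<Longrightarrow> j < m \<Longrightarrow>
    (D_xi P *\<^sub>v v) $ (i * m + j) = (\<Sum>k<m. D1 P $$ (i, k) * v $ (k * m + j))"
  unfolding D_xi_def using D1_carrier by (rule kron_one_right_mult_vec)

lemma D_eta_index:
  "v \<in> carrier_vec n \<Longrightarrow> i < m \<Longrightarrow> j < m \<Longrightarrow>
    (D_eta P *\<^sub>v v) $ (i * m + j) = (\<Sum>k<m. D1 P $$ (j, k) * v $ (i * m + k))"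
  unfolding D_eta_def using D1_carrier by (rule kron_one_left_mult_vec)

lemma sbp_xi:
  assumes "a \<in> carrier_vec n" "b \<in> carrier_vec n"
  shows "(\<Sum>k<n. w k * (a $ k * (D_xi P *\<^sub>v b) $ k)) + (\<Sum>k<n. w k * ((D_xi P *\<^sub>v a) $ k * b $ k))
    = (\<Sum>j<m. h j * (a $ east j * b $ east j)) - (\<Sum>j<m. h j * (a $ west j * b $ west j))"
proof -
  have "(\<Sum>k<n. w k * (a $ k * (D_xi P *\<^sub>v b) $ k)) + (\<Sum>k<n. w k * ((D_xi P *\<^sub>v a) $ k * b $ k))
    = (\<Sum>j<m. \<Sum>i<m. h i * h j * (a $ (i * m + j) * (D_xi P *\<^sub>v b) $ (i * m + j)))
      + (\<Sum>j<m. \<Sum>i<m. h i * h j * ((D_xi P *\<^sub>v a) $ (i * m + j) * b $ (i * m + j)))"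
    \<comment> \<open>The exchange makes the \<open>xi\<close> index innermost; for each fixed
      \<open>j\<close> the one-dimensional identity then applies to one grid line. In the
      \<open>eta\<close> direction the order is already right.\<close>
    unfolding sum_w by (intro arg_cong2[of _ _ _ _ "(+)"] sum.swap)
  also have "\<dots> = (\<Sum>j<m. h j *
      ((\<Sum>i<m. h i * a $ (i * m + j) * (D_xi P *\<^sub>v b) $ (i * m + j))
      + (\<Sum>i<m. h i * (D_xi P *\<^sub>v a) $ (i * m + j) * b $ (i * m + j))))"
    by (simp add: sum_distrib_left distrib_left sum.distrib[symmetric] ac_simps)
  also have "\<dots> = (\<Sum>j<m. h j * (a $ east j * b $ east j - a $ west j * b $ west j))"
  proof (rule sum.cong[OF refl])
    fix j assume "j \<in> {..<m}"
    then show "h j * ((\<Sum>i<m. h i * a $ (i * m + j) * (D_xi P *\<^sub>v b) $ (i * m + j))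
        + (\<Sum>i<m. h i * (D_xi P *\<^sub>v a) $ (i * m + j) * b $ (i * m + j)))
      = h j * (a $ east j * b $ east j - a $ west j * b $ west j)"
      using sbp_1d[of "\<lambda>i. a $ (i * m + j)" "\<lambda>i. b $ (i * m + j)"]
      by (simp add: D_xi_index assms east_def west_def)
  qed
  finally show ?thesis by (simp add: sum_subtractf right_diff_distrib)
qed

lemma sbp_eta:
  assumes "a \<in> carrier_vec n" "b \<in> carrier_vec n"
  shows "(\<Sum>k<n. w k * (a $ k * (D_eta P *\<^sub>v b) $ k)) + (\<Sum>k<n. w k * ((D_eta P *\<^sub>v a) $ k * b $ k))
    = (\<Sum>i<m. h i * (a $ north i * b $ north i)) - (\<Sum>i<m. h i * (a $ south i * b $ south i))"
proof -
  have "(\<Sum>k<n. w k * (a $ k * (D_eta P *\<^sub>v b) $ k)) + (\<Sum>k<n. w k * ((D_eta P *\<^sub>v a) $ k * b $ k))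
    = (\<Sum>i<m. \<Sum>j<m. h i * h j * (a $ (i * m + j) * (D_eta P *\<^sub>v b) $ (i * m + j)))
      + (\<Sum>i<m. \<Sum>j<m. h i * h j * ((D_eta P *\<^sub>v a) $ (i * m + j) * b $ (i * m + j)))"
    unfolding sum_w ..
  also have "\<dots> = (\<Sum>i<m. h i *
      ((\<Sum>j<m. h j * a $ (i * m + j) * (D_eta P *\<^sub>v b) $ (i * m + j))
      + (\<Sum>j<m. h j * (D_eta P *\<^sub>v a) $ (i * m + j) * b $ (i * m + j))))"
    by (simp add: sum_distrib_left distrib_left sum.distrib[symmetric] ac_simps)
  also have "\<dots> = (\<Sum>i<m. h i * (a $ north i * b $ north i - a $ south i * b $ south i))"
  proof (rule sum.cong[OF refl])
    fix i assume "i \<in> {..<m}"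
    then show "h i * ((\<Sum>j<m. h j * a $ (i * m + j) * (D_eta P *\<^sub>v b) $ (i * m + j))
        + (\<Sum>j<m. h j * (D_eta P *\<^sub>v a) $ (i * m + j) * b $ (i * m + j)))
      = h i * (a $ north i * b $ north i - a $ south i * b $ south i)"
      using sbp_1d[of "\<lambda>j. a $ (i * m + j)" "\<lambda>j. b $ (i * m + j)"]
      by (simp add: D_eta_index assms north_def south_def)
  qed
  finally show ?thesis by (simp add: sum_subtractf right_diff_distrib)
qed

section \<open>Restriction to the four sides as index selection\<close>

lemma e_w_eq: "e_w P = selection m n west"
proof (rule eq_matI)
  fix j k assume "j < dim_row (selection m n west)" "k < dim_col (selection m n west)"
  then have jk: "j < m" "k < n" by auto
  have "k div m = 0 \<and> j = k mod m \<longleftrightarrow> k = j"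
    using jk by (auto simp: div_eq_0_iff)
  then show "e_w P $$ (j, k) = selection m n west $$ (j, k)"
    using jk by (auto simp: e_w_def kron_def west_def e_left_eq selection_def less_mult_imp_div_less)
qed (simp_all add: e_w_def e_left_eq)

lemma e_e_eq: "e_e P = selection m n east"
proof (rule eq_matI)
  fix j k assume "j < dim_row (selection m n east)" "k < dim_col (selection m n east)"
  then have jk: "j < m" "k < n" by auto
  have "k div m = m - 1 \<and> j = k mod m \<longleftrightarrow> k = (m - 1) * m + j"
    using jk pair_index_iff[of j m k "m - 1"] by auto
  then show "e_e P $$ (j, k) = selection m n east $$ (j, k)"
    using jk by (auto simp: e_e_def kron_def east_def e_right_eq selection_def less_mult_imp_div_less)
qed (simp_all add: e_e_def e_right_eq)

lemma e_s_eq: "e_s P = selection m n south"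
proof (rule eq_matI)
  fix i k assume "i < dim_row (selection m n south)" "k < dim_col (selection m n south)"
  then have ik: "i < m" "k < n" by auto
  have "k mod m = 0 \<and> i = k div m \<longleftrightarrow> k = i * m"
    using ik by auto
  then show "e_s P $$ (i, k) = selection m n south $$ (i, k)"
    using ik by (auto simp: e_s_def kron_def south_def e_left_eq selection_def less_mult_imp_div_less)
qed (simp_all add: e_s_def e_left_eq)

lemma e_n_eq: "e_n P = selection m n north"
proof (rule eq_matI)
  fix i k assume "i < dim_row (selection m n north)" "k < dim_col (selection m n north)"
  then have ik: "i < m" "k < n" by auto
  have "k mod m = m - 1 \<and> i = k div m \<longleftrightarrow> k = i * m + (m - 1)"
    using ik pair_index_iff[of "m - 1" m k i] by auto
  then show "e_n P $$ (i, k) = selection m n north $$ (i, k)"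
    using ik by (auto simp: e_n_def kron_def north_def e_right_eq selection_def less_mult_imp_div_less)
qed (simp_all add: e_n_def e_right_eq)

lemmas e_eq = e_w_eq e_e_eq e_s_eq e_n_eq

lemma side_less [simp]:
  assumes "j < m"
  shows "west j < n" "east j < n" "south j < n" "north j < n"
  unfolding west_def east_def south_def north_def
  using assms pair_index_less[of 0 m j m] pair_index_less[of "m - 1" m j m]
    pair_index_less[of j m 0 m] pair_index_less[of j m "m - 1" m] by auto

lemma side_inj: "inj_on west {..<m}" "inj_on east {..<m}" "inj_on south {..<m}" "inj_on north {..<m}"
proof -
  have "m \<noteq> 0" using npts_ge by simp
  then show "inj_on west {..<m}" "inj_on east {..<m}" "inj_on south {..<m}" "inj_on north {..<m}"
    unfolding inj_on_def west_def east_def south_def north_def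
    by (simp_all only: add_right_cancel add_left_cancel mult_cancel2) simp_all
qed

end

section \<open>The energy identity on a single block\<close>

locale curvilinear_block = sbp_operators +
  fixes F :: block
  assumes positive_Jacobian: "positive_Jacobian P F"
begin

text \<open>Metric terms as functions of the flat index. The first letter is the physical
  coordinate, the second the reference direction: \<open>x\<close> for \<open>xi\<close>,
  \<open>e\<close> for \<open>eta\<close>.\<close>

definition xx :: "nat \<Rightarrow> real" where "xx k = (D_xi P *\<^sub>v x_coords P F) $ k"
definition xe :: "nat \<Rightarrow> real" where "xe k = (D_eta P *\<^sub>v x_coords P F) $ k"
definition yx :: "nat \<Rightarrow> real" where "yx k = (D_xi P *\<^sub>v y_coords P F) $ k"
definition ye :: "nat \<Rightarrow> real" where "ye k = (D_eta P *\<^sub>v y_coords P F) $ k"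
definition jac :: "nat \<Rightarrow> real" where "jac k = xx k * ye k - xe k * yx k"
definition w1 :: "nat \<Rightarrow> real" where "w1 k = sqrt (xx k * xx k + yx k * yx k)"
definition w2 :: "nat \<Rightarrow> real" where "w2 k = sqrt (xe k * xe k + ye k * ye k)"

lemma vdiag_D_xi: "vdiag (D_xi P *\<^sub>v v) = mat_diag n (\<lambda>k. (D_xi P *\<^sub>v v) $ k)"
  and vdiag_D_eta: "vdiag (D_eta P *\<^sub>v v) = mat_diag n (\<lambda>k. (D_eta P *\<^sub>v v) $ k)"
  by (simp_all add: vdiag_def)

lemma metric_eq: "X_xi P F = mat_diag n xx" "X_eta P F = mat_diag n xe"
    "Y_xi P F = mat_diag n yx" "Y_eta P F = mat_diag n ye"
  by (simp_all add: X_xi_def X_eta_def Y_xi_def Y_eta_def vdiag_D_xi vdiag_D_eta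
      xx_def[abs_def] xe_def[abs_def] yx_def[abs_def] ye_def[abs_def])

lemma Jac_eq: "Jac P F = mat_diag n jac"
  by (simp add: Jac_def metric_eq mat_diag_minus jac_def[abs_def])

lemma jac_pos: "k < n \<Longrightarrow> 0 < jac k"
  using positive_Jacobian by (auto simp: positive_Jacobian_def Jac_eq mat_diag_def)

lemma minv_Jac: "minv (Jac P F) = mat_diag n (\<lambda>k. inverse (jac k))"
  unfolding Jac_eq using jac_pos by (intro minv_mat_diag) (metis less_irrefl)

lemma W1_eq: "W1 P F = mat_diag n w1" and W2_eq: "W2 P F = mat_diag n w2"
  by (simp_all add: W1_def W2_def metric_eq mat_diag_add dsqrt_mat_diag w1_def[abs_def] w2_def[abs_def])

text \<open>If either tangent vector vanished at a point, the determinant \<open>jac\<close> would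
  vanish there too. This is what makes the inverses in the unit normals meaningful.\<close>

lemma w1_pos: "k < n \<Longrightarrow> 0 < w1 k" and w2_pos: "k < n \<Longrightarrow> 0 < w2 k"
proof -
  assume "k < n"
  then have "jac k \<noteq> 0" using jac_pos by force
  then have "xx k \<noteq> 0 \<or> yx k \<noteq> 0" "xe k \<noteq> 0 \<or> ye k \<noteq> 0" by (auto simp: jac_def)
  then show "0 < w1 k" "0 < w2 k"
    by (simp_all add: w1_def w2_def sum_squares_gt_zero_iff)
qed

lemma minv_W1: "minv (W1 P F) = mat_diag n (\<lambda>k. inverse (w1 k))"
  and minv_W2: "minv (W2 P F) = mat_diag n (\<lambda>k. inverse (w2 k))"
  unfolding W1_eq W2_eq using w1_pos w2_pos by (intro minv_mat_diag; force)+

lemma block_H_eq: "block_H P F = mat_diag n (\<lambda>k. w k * jac k)"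
  by (simp add: block_H_def HH_eq Jac_eq)

section \<open>Laplacian, gradient and fluxes acting on a grid vector\<close>

lemma block_Lap_carrier [simp]: "block_Lap P F \<in> carrier_mat n n"
  and D_x_carrier [simp]: "D_x P F \<in> carrier_mat n n"
  and D_y_carrier [simp]: "D_y P F \<in> carrier_mat n n"
  by (rule carrier_matI; simp add: block_Lap_def D_x_def D_y_def D_eta_eta_def minv_Jac metric_eq)+

lemma D_xy_vec_carrier [simp]: "D_x P F *\<^sub>v v \<in> carrier_vec n" "D_y P F *\<^sub>v v \<in> carrier_vec n"
  by (rule carrier_vecI, simp add: carrier_matD[OF D_x_carrier] carrier_matD[OF D_y_carrier])+

text \<open>Contravariant components of the gradient, scaled by the Jacobian.\<close>

definition flux_xi :: "real vec \<Rightarrow> nat \<Rightarrow> real" where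
  "flux_xi v k = ((xe k * xe k + ye k * ye k) * (D_xi P *\<^sub>v v) $ k
     - (xx k * xe k + yx k * ye k) * (D_eta P *\<^sub>v v) $ k) / jac k"

definition flux_eta :: "real vec \<Rightarrow> nat \<Rightarrow> real" where
  "flux_eta v k = ((xx k * xx k + yx k * yx k) * (D_eta P *\<^sub>v v) $ k
     - (xx k * xe k + yx k * ye k) * (D_xi P *\<^sub>v v) $ k) / jac k"

lemma alpha1_eq: "alpha1 P F = mat_diag n (\<lambda>k. (xe k * xe k + ye k * ye k) / jac k)"
  and alpha2_eq: "alpha2 P F = mat_diag n (\<lambda>k. (xx k * xx k + yx k * yx k) / jac k)"
  and beta_eq: "beta P F = mat_diag n (\<lambda>k. - ((xx k * xe k + yx k * ye k) / jac k))"
  by (simp_all add: alpha1_def alpha2_def beta_def metric_eq minv_Jac mat_diag_add mat_diag_uminus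
      divide_inverse mult.commute)

text \<open>Divergence form: the four terms of the Laplacian are grouped by their outer derivative.
  The mixed terms enter the fluxes with a minus sign because \<open>beta\<close> carries
  one.\<close>

lemma block_Lap_mult_vec:
  assumes v: "v \<in> carrier_vec n"
  shows "block_Lap P F *\<^sub>v v = vec n (\<lambda>k. inverse (jac k) *
    ((D_xi P *\<^sub>v vec n (flux_xi v)) $ k + (D_eta P *\<^sub>v vec n (flux_eta v)) $ k))"
proof -
  define p q where "p = D_xi P *\<^sub>v v" and "q = D_eta P *\<^sub>v v"
  have p: "p \<in> carrier_vec n" and q: "q \<in> carrier_vec n"
    by (simp_all add: p_def q_def)
  have fx: "vec n (flux_xi v) = alpha1 P F *\<^sub>v p + beta P F *\<^sub>v q"
    using p q by (auto simp: alpha1_eq beta_eq mat_diag_mult_vec flux_xi_def p_def[symmetric] q_def[symmetric]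
        diff_divide_distrib )
  have fe: "vec n (flux_eta v) = beta P F *\<^sub>v p + alpha2 P F *\<^sub>v q"
    using p q by (auto simp: alpha2_eq beta_eq mat_diag_mult_vec flux_eta_def p_def[symmetric] q_def[symmetric]
        diff_divide_distrib )
  have ab: "alpha1 P F \<in> carrier_mat n n" "alpha2 P F \<in> carrier_mat n n" "beta P F \<in> carrier_mat n n"
    by (simp_all add: alpha1_eq alpha2_eq beta_eq)
  have "(D_xi_xi P (alpha1 P F) + D_eta P * beta P F * D_xi P + D_xi P * beta P F * D_eta P
      + D_eta_eta P (alpha2 P F)) *\<^sub>v v
      = D_xi P *\<^sub>v (alpha1 P F *\<^sub>v p) + D_eta P *\<^sub>v (beta P F *\<^sub>v p)
        + D_xi P *\<^sub>v (beta P F *\<^sub>v q) + D_eta P *\<^sub>v (alpha2 P F *\<^sub>v q)"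
    using v ab by (simp add: D_xi_xi_def D_eta_eta_def p_def q_def add_mult_distrib_mat_vec[of _ n n]
        assoc_mult_mat_vec[of _ n n _ n] mult_carrier_mat[of _ n n _ n])
  also have "\<dots> = D_xi P *\<^sub>v vec n (flux_xi v) + D_eta P *\<^sub>v vec n (flux_eta v)"
    unfolding fx fe using p q ab
    by (intro eq_vecI) (simp_all add: mult_add_distrib_mat_vec[of _ n n])
  finally have main: "(D_xi_xi P (alpha1 P F) + D_eta P * beta P F * D_xi P + D_xi P * beta P F * D_eta P
      + D_eta_eta P (alpha2 P F)) *\<^sub>v v
      = D_xi P *\<^sub>v vec n (flux_xi v) + D_eta P *\<^sub>v vec n (flux_eta v)" .
  have "D_xi_xi P (alpha1 P F) + D_eta P * beta P F * D_xi P + D_xi P * beta P F * D_eta P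
      + D_eta_eta P (alpha2 P F) \<in> carrier_mat n n"
    using ab by (simp add: D_xi_xi_def D_eta_eta_def mult_carrier_mat[of _ n n _ n])
  with v have "block_Lap P F *\<^sub>v v = minv (Jac P F) *\<^sub>v
      (D_xi P *\<^sub>v vec n (flux_xi v) + D_eta P *\<^sub>v vec n (flux_eta v))"
    by (simp add: block_Lap_def minv_Jac assoc_mult_mat_vec[of _ n n _ n] main)
  also have "\<dots> = vec n (\<lambda>k. inverse (jac k) *
    ((D_xi P *\<^sub>v vec n (flux_xi v)) $ k + (D_eta P *\<^sub>v vec n (flux_eta v)) $ k))"
    unfolding minv_Jac
    by (subst mat_diag_mult_vec) (auto intro!: add_carrier_vec mult_mat_vec_carrier[of _ n n]
        )
  finally show ?thesis .
qed

lemma D_x_mult_vec: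
  assumes v: "v \<in> carrier_vec n"
  shows "D_x P F *\<^sub>v v = vec n (\<lambda>k. (ye k * (D_xi P *\<^sub>v v) $ k - yx k * (D_eta P *\<^sub>v v) $ k) / jac k)"
  using v by (auto simp: D_x_def minv_Jac metric_eq minus_mult_distrib_mat_vec[of _ n n]
      assoc_mult_mat_vec[of _ n n _ n] mat_diag_mult_vec divide_inverse mult.commute
      mult_carrier_mat[of _ n n _ n] minus_carrier_mat[of _ n n]
      )

lemma D_y_mult_vec:
  assumes v: "v \<in> carrier_vec n"
  shows "D_y P F *\<^sub>v v = vec n (\<lambda>k. (xx k * (D_eta P *\<^sub>v v) $ k - xe k * (D_xi P *\<^sub>v v) $ k) / jac k)"
proof -
  \<comment> \<open>Written as a difference, \<open>D_y\<close> can be evaluated exactly as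
    \<open>D_x\<close> was.\<close>
  have "- A + B = B - A" if "A \<in> carrier_mat n n" "B \<in> carrier_mat n n" for A B :: "real mat"
    using that by (intro eq_matI) auto
  then have "D_y P F = minv (Jac P F) * (X_xi P F * D_eta P - X_eta P F * D_xi P)"
    unfolding D_y_def metric_eq by (simp add: mult_carrier_mat[of _ n n _ n])
  then show ?thesis
    using v by (auto simp: minv_Jac metric_eq minus_mult_distrib_mat_vec[of _ n n]
      assoc_mult_mat_vec[of _ n n _ n] mat_diag_mult_vec divide_inverse mult.commute
      mult_carrier_mat[of _ n n _ n] minus_carrier_mat[of _ n n]
      )
qed

text \<open>Expanding the two products gives the quadratic form with coefficients
  \<open>xe\<^sup>2 + ye\<^sup>2\<close>, \<open>-(xx xe + yx ye)\<close> and
  \<open>xx\<^sup>2 + yx\<^sup>2\<close>; the factor \<open>jac\<close> cancels one of the two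
  divisions by it, leaving the coefficients of the fluxes.\<close>

lemma gradient_energy:
  assumes k: "k < n" and u: "u \<in> carrier_vec n" and v: "v \<in> carrier_vec n"
  shows "jac k * ((D_x P F *\<^sub>v u) $ k * (D_x P F *\<^sub>v v) $ k + (D_y P F *\<^sub>v u) $ k * (D_y P F *\<^sub>v v) $ k)
    = (D_xi P *\<^sub>v u) $ k * flux_xi v k + (D_eta P *\<^sub>v u) $ k * flux_eta v k"
  using jac_pos[OF k] k
  by (simp add: D_x_mult_vec u v D_y_mult_vec flux_xi_def flux_eta_def field_simps)

text \<open>The vector \<open>(ye, - xe)\<close> is orthogonal to the tangent
  \<open>(xe, ye)\<close> of a line of constant \<open>xi\<close> and has length \<open>w2\<close>.
  It is \<open>w2\<close> times the outward unit normal on the east side and \<open>- w2\<close>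
  times it on the west side.\<close>

lemma flux_xi_normal:
  assumes k: "k < n" and v: "v \<in> carrier_vec n"
  shows "ye k * (D_x P F *\<^sub>v v) $ k - xe k * (D_y P F *\<^sub>v v) $ k = flux_xi v k"
  using jac_pos[OF k] k
  by (simp add: D_x_mult_vec v D_y_mult_vec flux_xi_def field_simps)

text \<open>Likewise \<open>(- yx, xx)\<close> is \<open>w1\<close> times the outward unit normal on
  the north side and \<open>- w1\<close> times it on the south side.\<close>

lemma flux_eta_normal:
  assumes k: "k < n" and v: "v \<in> carrier_vec n"
  shows "xx k * (D_y P F *\<^sub>v v) $ k - yx k * (D_x P F *\<^sub>v v) $ k = flux_eta v k"
  using jac_pos[OF k] k
  by (simp add: D_x_mult_vec v D_y_mult_vec flux_eta_def field_simps)

section \<open>Arc-length quadratures, unit normals and normal derivatives\<close>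

lemma Hmat_selection_conj:
  assumes "\<And>j. j < m \<Longrightarrow> s j < n" "inj_on s {..<m}"
  shows "Hmat P * selection m n s * mat_diag n f * transpose_mat (selection m n s)
    = mat_diag m (\<lambda>j. h j * f (s j))"
proof -
  have "Hmat P * selection m n s * mat_diag n f * transpose_mat (selection m n s)
    = Hmat P * (selection m n s * mat_diag n f * transpose_mat (selection m n s))"
    using Hmat_carrier
    by (simp add: assoc_mult_mat[of _ m m _ n _ n] assoc_mult_mat[of _ m m _ n _ m]
        mult_carrier_mat[of _ m n _ n])
  then show ?thesis using selection_diag_conj[OF assms] by (simp add: Hmat_eq)
qed

lemma boundary_quadrature_eq:
  "H_w P F = mat_diag m (\<lambda>j. h j * w2 (west j))"
  "H_e P F = mat_diag m (\<lambda>j. h j * w2 (east j))"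
  "H_s P F = mat_diag m (\<lambda>j. h j * w1 (south j))"
  "H_n P F = mat_diag m (\<lambda>j. h j * w1 (north j))"
  unfolding H_w_def H_e_def H_s_def H_n_def e_eq W1_eq W2_eq
  by (simp_all only: Hmat_selection_conj side_less side_inj)

lemma selection_quotient_conj:
  assumes "\<And>j. j < m \<Longrightarrow> s j < n" "inj_on s {..<m}"
  shows "selection m n s * mat_diag n (\<lambda>k. inverse (f k)) * mat_diag n g * transpose_mat (selection m n s)
    = mat_diag m (\<lambda>j. g (s j) / f (s j))"
  using selection_diag_conj[OF assms]
  by (simp add: assoc_mult_mat[of _ m n _ n _ n] divide_inverse mult.commute)

lemma normal_eq:
  "n1_w P F = mat_diag m (\<lambda>j. - (ye (west j) / w2 (west j)))"
  "n2_w P F = mat_diag m (\<lambda>j. xe (west j) / w2 (west j))"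
  "n1_e P F = mat_diag m (\<lambda>j. ye (east j) / w2 (east j))"
  "n2_e P F = mat_diag m (\<lambda>j. - (xe (east j) / w2 (east j)))"
  "n1_s P F = mat_diag m (\<lambda>j. yx (south j) / w1 (south j))"
  "n2_s P F = mat_diag m (\<lambda>j. - (xx (south j) / w1 (south j)))"
  "n1_n P F = mat_diag m (\<lambda>j. - (yx (north j) / w1 (north j)))"
  "n2_n P F = mat_diag m (\<lambda>j. xx (north j) / w1 (north j))"
  unfolding n1_w_def n2_w_def n1_e_def n2_e_def n1_s_def n2_s_def n1_n_def n2_n_def
    e_eq metric_eq minv_W1 minv_W2
  by (simp_all only: selection_quotient_conj side_less side_inj mat_diag_uminus)

lemma normal_derivative_mult_vec:
  assumes v: "v \<in> carrier_vec n" and s: "\<And>j. j < m \<Longrightarrow> s j < n"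
  shows "(mat_diag m f * selection m n s * D_x P F + mat_diag m g * selection m n s * D_y P F) *\<^sub>v v
    = vec m (\<lambda>j. f j * (D_x P F *\<^sub>v v) $ s j + g j * (D_y P F *\<^sub>v v) $ s j)"
proof -
  have "(mat_diag m f * selection m n s * D_x P F + mat_diag m g * selection m n s * D_y P F) *\<^sub>v v
    = mat_diag m f *\<^sub>v (selection m n s *\<^sub>v (D_x P F *\<^sub>v v))
      + mat_diag m g *\<^sub>v (selection m n s *\<^sub>v (D_y P F *\<^sub>v v))"
    using v by (simp add: add_mult_distrib_mat_vec[of _ m n] assoc_mult_mat_vec[of _ m n _ n]
        assoc_mult_mat_vec[of _ m m _ n] mult_carrier_mat[of _ m n] mult_carrier_mat[of _ m m]
        mult_mat_vec_carrier[of _ n n])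
  also have "\<dots> = vec m (\<lambda>j. f j * (D_x P F *\<^sub>v v) $ s j + g j * (D_y P F *\<^sub>v v) $ s j)"
    by (auto simp: mat_diag_mult_vec selection_mult_vec[of m s n] s )
  finally show ?thesis .
qed

text \<open>The signs record that the outward normal points against increasing \<open>xi\<close> on
  the west side and against increasing \<open>eta\<close> on the south side.\<close>

lemma d_mult_vec:
  assumes v: "v \<in> carrier_vec n"
  shows "d_w P F *\<^sub>v v = vec m (\<lambda>j. - (flux_xi v (west j) / w2 (west j)))"
    "d_e P F *\<^sub>v v = vec m (\<lambda>j. flux_xi v (east j) / w2 (east j))"
    "d_s P F *\<^sub>v v = vec m (\<lambda>j. - (flux_eta v (south j) / w1 (south j)))"
    "d_n P F *\<^sub>v v = vec m (\<lambda>j. flux_eta v (north j) / w1 (north j))"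
  unfolding d_w_def d_e_def d_s_def d_n_def e_eq normal_eq
  by (auto simp: normal_derivative_mult_vec v flux_xi_normal[symmetric] flux_eta_normal[symmetric]
      diff_divide_distrib)

lemma d_carrier [simp]: "d_w P F \<in> carrier_mat m n" "d_e P F \<in> carrier_mat m n"
    "d_s P F \<in> carrier_mat m n" "d_n P F \<in> carrier_mat m n"
  unfolding d_w_def d_e_def d_s_def d_n_def e_eq normal_eq
  by (rule carrier_matI; simp add: carrier_matD[OF D_y_carrier])+

text \<open>The arc-length factor in the quadrature cancels the one dividing the flux in the normal
  derivative. What is left are the boundary sums of \<open>sbp_xi\<close> and \<open>sbp_eta\<close>
  with a flux as second argument.\<close>

lemma boundary_ip:
  assumes u: "u \<in> carrier_vec n" and v: "v \<in> carrier_vec n"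
  shows "ip (H_w P F) (e_w P *\<^sub>v u) (d_w P F *\<^sub>v v) = - (\<Sum>j<m. h j * (u $ west j * flux_xi v (west j)))"
    "ip (H_e P F) (e_e P *\<^sub>v u) (d_e P F *\<^sub>v v) = (\<Sum>j<m. h j * (u $ east j * flux_xi v (east j)))"
    "ip (H_s P F) (e_s P *\<^sub>v u) (d_s P F *\<^sub>v v) = - (\<Sum>j<m. h j * (u $ south j * flux_eta v (south j)))"
    "ip (H_n P F) (e_n P *\<^sub>v u) (d_n P F *\<^sub>v v) = (\<Sum>j<m. h j * (u $ north j * flux_eta v (north j)))"
  unfolding boundary_quadrature_eq e_eq d_mult_vec[OF v]
  by (auto simp: ip_mat_diag selection_mult_vec u sum_negf[symmetric] less_imp_neq[OF w1_pos, symmetric]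
      less_imp_neq[OF w2_pos, symmetric] intro!: sum.cong)

lemma block_sbp:
  assumes u: "u \<in> carrier_vec n" and v: "v \<in> carrier_vec n"
  shows "ip (block_H P F) u (block_Lap P F *\<^sub>v v) =
    - ip (block_H P F) (D_x P F *\<^sub>v u) (D_x P F *\<^sub>v v) - ip (block_H P F) (D_y P F *\<^sub>v u) (D_y P F *\<^sub>v v)
    + ip (H_w P F) (e_w P *\<^sub>v u) (d_w P F *\<^sub>v v) + ip (H_e P F) (e_e P *\<^sub>v u) (d_e P F *\<^sub>v v)
    + ip (H_s P F) (e_s P *\<^sub>v u) (d_s P F *\<^sub>v v) + ip (H_n P F) (e_n P *\<^sub>v u) (d_n P F *\<^sub>v v)"
proof -
  let ?f = "vec n (flux_xi v)" and ?g = "vec n (flux_eta v)"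
  have "ip (block_H P F) u (block_Lap P F *\<^sub>v v)
      = (\<Sum>k<n. w k * (u $ k * (D_xi P *\<^sub>v ?f) $ k)) + (\<Sum>k<n. w k * (u $ k * (D_eta P *\<^sub>v ?g) $ k))"
    unfolding block_H_eq block_Lap_mult_vec[OF v] sum.distrib[symmetric]
  proof (subst ip_mat_diag, simp, intro sum.cong[OF refl])
    fix k assume "k \<in> {..<n}"
    then show "w k * jac k * u $ k *
         vec n (\<lambda>k. inverse (jac k) * ((D_xi P *\<^sub>v ?f) $ k + (D_eta P *\<^sub>v ?g) $ k)) $ k =
         w k * (u $ k * (D_xi P *\<^sub>v ?f) $ k) + w k * (u $ k * (D_eta P *\<^sub>v ?g) $ k)"
      using jac_pos[of k] by (simp add: field_simps)
  qed
  \<comment> \<open>These volume terms appear once the outer derivatives have moved onto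
    \<open>u\<close>; \<open>gradient_energy\<close> identifies them at each point.\<close>
  moreover have "(\<Sum>k<n. w k * ((D_xi P *\<^sub>v u) $ k * ?f $ k)) + (\<Sum>k<n. w k * ((D_eta P *\<^sub>v u) $ k * ?g $ k))
      = ip (block_H P F) (D_x P F *\<^sub>v u) (D_x P F *\<^sub>v v) + ip (block_H P F) (D_y P F *\<^sub>v u) (D_y P F *\<^sub>v v)"
    unfolding block_H_eq ip_mat_diag[OF D_xy_vec_carrier(1)] ip_mat_diag[OF D_xy_vec_carrier(2)] sum.distrib[symmetric]
  proof (intro sum.cong[OF refl])
    fix k assume k: "k \<in> {..<n}"
    have "w k * ((D_xi P *\<^sub>v u) $ k * ?f $ k) + w k * ((D_eta P *\<^sub>v u) $ k * ?g $ k)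
      = w k * ((D_xi P *\<^sub>v u) $ k * flux_xi v k + (D_eta P *\<^sub>v u) $ k * flux_eta v k)"
      using k by (simp add: distrib_left)
    also have "\<dots> = w k * (jac k * ((D_x P F *\<^sub>v u) $ k * (D_x P F *\<^sub>v v) $ k
        + (D_y P F *\<^sub>v u) $ k * (D_y P F *\<^sub>v v) $ k))"
      using gradient_energy[of k u v] k u v by simp
    finally show "w k * ((D_xi P *\<^sub>v u) $ k * ?f $ k) + w k * ((D_eta P *\<^sub>v u) $ k * ?g $ k)
      = w k * jac k * (D_x P F *\<^sub>v u) $ k * (D_x P F *\<^sub>v v) $ k
        + w k * jac k * (D_y P F *\<^sub>v u) $ k * (D_y P F *\<^sub>v v) $ k"
      by (simp add: algebra_simps)
  qed
  \<comment> \<open>Matches the boundary sums for flux vectors with those of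
    \<open>boundary_ip\<close>, where the fluxes are functions.\<close>
  moreover have "(\<Sum>j<m. h j * (u $ s j * vec n f $ s j)) = (\<Sum>j<m. h j * (u $ s j * f (s j)))"
    if "\<And>j. j < m \<Longrightarrow> s j < n" for s f using that by (auto intro!: sum.cong)
  ultimately show ?thesis
    \<comment> \<open>Summation by parts pairs \<open>u\<close> with the \<open>xi\<close> flux in
      the first direction and with the \<open>eta\<close> flux in the second, each producing two of
      the four sides.\<close>
    using sbp_xi[OF u, of ?f] sbp_eta[OF u, of ?g]
    by (simp add: boundary_ip[OF u v])
qed

end

section \<open>Block diagonal matrices\<close>

lemma bdiag_carrier [simp]:
  "A \<in> carrier_mat ra ca \<Longrightarrow> B \<in> carrier_mat rb cb \<Longrightarrow> bdiag A B \<in> carrier_mat (ra + rb) (ca + cb)"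
  by (auto simp: bdiag_def)

lemma bdiag_mult_vec:
  assumes A: "A \<in> carrier_mat ra ca" and B: "B \<in> carrier_mat rb cb"
    and a: "a \<in> carrier_vec ca" and b: "b \<in> carrier_vec cb"
  shows "bdiag A B *\<^sub>v (a @\<^sub>v b) = A *\<^sub>v a @\<^sub>v B *\<^sub>v b"
proof -
  have Z: "0\<^sub>m ra cb *\<^sub>v b = 0\<^sub>v ra" "0\<^sub>m rb ca *\<^sub>v a = 0\<^sub>v rb"
    using a b by (auto simp: index_mult_mat_vec)
  have Ab: "A *\<^sub>v a \<in> carrier_vec ra" "B *\<^sub>v b \<in> carrier_vec rb" using A B a b by auto
  have "bdiag A B = four_block_mat A (0\<^sub>m ra cb) (0\<^sub>m rb ca) B"
    using A B by (simp add: bdiag_def)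
  then show ?thesis
    using four_block_mat_mult_vec[OF A zero_carrier_mat[of ra cb] zero_carrier_mat[of rb ca] B a b] Ab
    by (simp add: Z)
qed

lemma ip_bdiag:
  assumes A: "A \<in> carrier_mat ra ca" and B: "B \<in> carrier_mat rb cb"
    and a: "a \<in> carrier_vec ra" and b: "b \<in> carrier_vec rb"
    and c: "c \<in> carrier_vec ca" and d: "d \<in> carrier_vec cb"
  shows "ip (bdiag A B) (a @\<^sub>v b) (c @\<^sub>v d) = ip A a c + ip B b d"
  using scalar_prod_append[OF a b, of "A *\<^sub>v c" "B *\<^sub>v d"] A B c d
  by (simp add: ip_def bdiag_mult_vec[OF A B c d])

lemma bdiag_mat_diag:
  "bdiag (mat_diag k f) (mat_diag l g) = mat_diag (k + l) (\<lambda>i. if i < k then f i else g (i - k))"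
  by (intro eq_matI) (auto simp: bdiag_def mat_diag_def)

section \<open>The embedding operator\<close>

lemma ip_transpose:
  assumes "A \<in> carrier_mat r c" "M \<in> carrier_mat r c'" "a \<in> carrier_vec c" "b \<in> carrier_vec c'"
  shows "a \<bullet> (transpose_mat A *\<^sub>v (M *\<^sub>v b)) = ip M (A *\<^sub>v a) b"
proof -
  have Mb: "M *\<^sub>v b \<in> carrier_vec r" using assms by simp
  have "a \<bullet> (transpose_mat A *\<^sub>v (M *\<^sub>v b)) = (transpose_mat A *\<^sub>v (M *\<^sub>v b)) \<bullet> a"
    using assms Mb by (intro comm_scalar_prod[of _ c] mult_mat_vec_carrier[of _ c r]) auto
  also have "\<dots> = (M *\<^sub>v b) \<bullet> (A *\<^sub>v a)"
    by (rule transpose_vec_mult_scalar[OF assms(1,3) Mb])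
  also have "\<dots> = ip M (A *\<^sub>v a) b"
    unfolding ip_def using assms Mb by (intro comm_scalar_prod[of _ r]) auto
  finally show ?thesis .
qed

text \<open>\<open>B\<close> plays the inverse of the reduced inner product matrix. The inner
  product applies that matrix after \<open>B\<close>, so the right-inverse equation cancels both;
  the remaining \<open>transpose_mat E\<close> then moves onto \<open>u\<close>.\<close>

lemma ip_congruence:
  assumes E: "E \<in> carrier_mat r c" and H: "H \<in> carrier_mat r r" and L: "L \<in> carrier_mat r r"
    and B: "B \<in> carrier_mat c c" "transpose_mat E * H * E * B = 1\<^sub>m c"
    and u: "u \<in> carrier_vec c" and v: "v \<in> carrier_vec c"
  shows "ip (transpose_mat E * H * E) u (B * transpose_mat E * H * L * E *\<^sub>v v)
    = ip H (E *\<^sub>v u) (L *\<^sub>v (E *\<^sub>v v))"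
proof -
  define A where "A = transpose_mat E * H * E"
  have A: "A \<in> carrier_mat c c"
    using E H unfolding A_def by (intro mult_carrier_mat[of _ c r]) auto
  define x where "x = L *\<^sub>v (E *\<^sub>v v)"
  have x: "x \<in> carrier_vec r" using E L v by (auto simp: x_def)
  have ET: "transpose_mat E \<in> carrier_mat c r" using E by simp
  define y where "y = transpose_mat E *\<^sub>v (H *\<^sub>v x)"
  have y: "y \<in> carrier_vec c" using ET H x by (auto simp: y_def)
  have "B * transpose_mat E * H * L * E *\<^sub>v v = B *\<^sub>v y"
  proof -
    have 1: "B * transpose_mat E \<in> carrier_mat c r" using B(1) ET by (rule mult_carrier_mat)
    have 2: "B * transpose_mat E * H \<in> carrier_mat c r" using 1 H by (rule mult_carrier_mat)
    have 3: "B * transpose_mat E * H * L \<in> carrier_mat c r" using 2 L by (rule mult_carrier_mat)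
    have Ev: "E *\<^sub>v v \<in> carrier_vec r" and Hx: "H *\<^sub>v x \<in> carrier_vec r" using E H v x by auto
    show ?thesis
      unfolding assoc_mult_mat_vec[OF 3 E v] assoc_mult_mat_vec[OF 2 L Ev] x_def[symmetric]
        assoc_mult_mat_vec[OF 1 H x] assoc_mult_mat_vec[OF B(1) ET Hx] y_def ..
  qed
  then have "A *\<^sub>v (B * transpose_mat E * H * L * E *\<^sub>v v) = A * B *\<^sub>v y"
    using assoc_mult_mat_vec[OF A B(1) y] by simp
  also have "\<dots> = y" using B(2) y by (simp add: A_def)
  finally have "ip A u (B * transpose_mat E * H * L * E *\<^sub>v v) = u \<bullet> y"
    by (simp add: ip_def)
  also have "\<dots> = ip H (E *\<^sub>v u) x" unfolding y_def by (rule ip_transpose[OF E H u x])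
  finally show ?thesis unfolding A_def x_def .
qed

text \<open>Distinctness of the rows of \<open>S'\<close> gives each point one column, and equality
  of the row sets makes that column exist and every column occur. Surjectivity later yields
  positivity of the reduced weights; the last property yields continuity across the
  interface.\<close>

lemma embedding_selection:
  assumes "distinct_points_of S S'"
  obtains s where "embedding S S' = selection (dim_row S) (dim_row S') s"
    "\<And>i. i < dim_row S \<Longrightarrow> s i < dim_row S'"
    "\<And>j. j < dim_row S' \<Longrightarrow> \<exists>i<dim_row S. s i = j"
    "\<And>i j. i < dim_row S \<Longrightarrow> j < dim_row S \<Longrightarrow> row S i = row S j \<Longrightarrow> s i = s j"
proof -
  have set_rows: "set (rows A) = row A ` {..<dim_row A}" for A :: "real mat"
    by (auto simp: rows_def)
  have inj: "inj_on (row S') {..<dim_row S'}"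
    using assms by (simp add: distinct_points_of_def rows_def distinct_map atLeast0LessThan)
  have im: "row S' ` {..<dim_row S'} = row S ` {..<dim_row S}"
    using assms by (simp add: distinct_points_of_def set_rows)
  define s where "s i = the_inv_into {..<dim_row S'} (row S') (row S i)" for i
  have s: "s i < dim_row S'" "row S' (s i) = row S i" if "i < dim_row S" for i
  proof -
    have "row S i \<in> row S' ` {..<dim_row S'}" using that im by auto
    then show "s i < dim_row S'" "row S' (s i) = row S i"
      using the_inv_into_into[OF inj, of "row S i" "{..<dim_row S'}"] f_the_inv_into_f[OF inj]
      by (auto simp: s_def)
  qed
  have s_iff: "row S' j = row S i \<longleftrightarrow> j = s i" if "i < dim_row S" "j < dim_row S'" for i j
    using s[OF that(1)] that(2) inj_onD[OF inj, of j "s i"] by auto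
  show ?thesis
  proof
    show "embedding S S' = selection (dim_row S) (dim_row S') s"
      unfolding embedding_def selection_def by (intro cong_mat) (auto simp: s_iff)
    show "\<exists>i<dim_row S. s i = j" if j: "j < dim_row S'" for j
    proof -
      have "row S' j \<in> row S ` {..<dim_row S}" using j im by auto
      then obtain i where "i < dim_row S" "row S' j = row S i" by auto
      then show ?thesis using s_iff j by auto
    qed
    show "s i < dim_row S'" if "i < dim_row S" for i by (rule s(1)[OF that])
  qed (simp add: s_def)
qed

section \<open>The two-block domain\<close>

text \<open>Both blocks are built on the same \<open>P\<close>, so the weights \<open>h\<close> and
  the side indices are common to them; only the metric quantities need the prefixes \<open>L\<close>
  and \<open>R\<close>.\<close>

locale two_block = sbp_operators P + L: curvilinear_block P Fl + R: curvilinear_block P Fr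
  for P Fl Fr +
  assumes two_block_domain: "two_block_domain P Fl Fr"
begin

lemma coords_interface:
  assumes "j < m"
  shows "x_coords P Fl $ east j = x_coords P Fr $ west j"
    "y_coords P Fl $ east j = y_coords P Fr $ west j"
proof -
  have c: "x_coords P F \<in> carrier_vec n" "y_coords P F \<in> carrier_vec n" for F
    by (simp_all add: x_coords_def y_coords_def)
  have "vec m (\<lambda>j. x_coords P Fl $ east j) = vec m (\<lambda>j. x_coords P Fr $ west j)"
    "vec m (\<lambda>j. y_coords P Fl $ east j) = vec m (\<lambda>j. y_coords P Fr $ west j)"
    using two_block_domain
    by (simp_all add: two_block_domain_def Let_def e_eq selection_mult_vec c)
  then show "x_coords P Fl $ east j = x_coords P Fr $ west j"
    "y_coords P Fl $ east j = y_coords P Fr $ west j"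
    using assms by (metis index_vec)+
qed

text \<open>The tangential derivatives of the coordinates only involve points on the interface, so the
  two blocks see the same arc length element there.\<close>

lemma w2_interface:
  assumes j: "j < m"
  shows "L.w2 (east j) = R.w2 (west j)"
proof -
  have c: "x_coords P F \<in> carrier_vec n" "y_coords P F \<in> carrier_vec n" for F
    by (simp_all add: x_coords_def y_coords_def)
  have m: "m - 1 < m" "0 < m" using npts_ge by auto
  \<comment> \<open>Brings \<open>west\<close> into the form \<open>i * m + j\<close> required by
    \<open>D_eta_index\<close>, with \<open>xi\<close> index 0; the east side has \<open>xi\<close>
    index \<open>m - 1\<close>. Differentiating in \<open>eta\<close> keeps this index
    fixed.\<close>
  have w: "west k = 0 * m + k" for k by (simp add: west_def)
  have "L.xe (east j) = R.xe (west j)" "L.ye (east j) = R.ye (west j)"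
    using coords_interface
    unfolding L.xe_def R.xe_def L.ye_def R.ye_def w east_def
      D_eta_index[OF c(1) m(1) j] D_eta_index[OF c(1) m(2) j]
      D_eta_index[OF c(2) m(1) j] D_eta_index[OF c(2) m(2) j]
    by (auto intro!: sum.cong)
  then show ?thesis by (simp add: L.w2_def R.w2_def)
qed

lemma quadrature_interface: "H_e P Fl = H_w P Fr"
  unfolding L.boundary_quadrature_eq R.boundary_quadrature_eq
  by (rule mat_diag_cong) (simp add: w2_interface)

text \<open>This makes the embedding send both copies of an interface point to one column. The
  offset \<open>n\<close> leads to the rows of the right block.\<close>

lemma row_grid_points_interface:
  assumes j: "j < m"
  shows "row (grid_points P Fl Fr) (east j) = row (grid_points P Fl Fr) (n + west j)"
proof (rule eq_vecI)
  fix i assume "i < dim_vec (row (grid_points P Fl Fr) (n + west j))"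
  then have "i = 0 \<or> i = 1" by (auto simp: grid_points_def)
  moreover have d: "dim_vec (x_coords P F) = n" "dim_vec (y_coords P F) = n" for F
    by (simp_all add: x_coords_def y_coords_def)
  moreover have "east j < n" "west j < n" using side_less[OF j] by auto
  ultimately show "row (grid_points P Fl Fr) (east j) $ i = row (grid_points P Fl Fr) (n + west j) $ i"
    using coords_interface[OF j]
    by (auto simp: grid_points_def mat_of_cols_index)
qed simp

section \<open>The composite inner product and the interface correction\<close>

definition hj :: "nat \<Rightarrow> real" where
  "hj i = (if i < n then w i * L.jac i else w (i - n) * R.jac (i - n))"

lemma H_plus_eq: "H_plus P Fl Fr = mat_diag (n + n) hj"
  by (simp add: H_plus_def L.block_H_eq R.block_H_eq bdiag_mat_diag hj_def[abs_def])

lemma hj_pos: "i < n + n \<Longrightarrow> 0 < hj i"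
  using w_pos[of i] w_pos[of "i - n"] L.jac_pos[of i] R.jac_pos[of "i - n"] by (auto simp: hj_def)

lemma side_carrier [simp]: "e_w P \<in> carrier_mat m n" "e_e P \<in> carrier_mat m n"
  "e_s P \<in> carrier_mat m n" "e_n P \<in> carrier_mat m n"
  by (simp_all add: e_eq)

lemma boundary_quadrature_carrier [simp]:
  "H_w P Fl \<in> carrier_mat m m" "H_e P Fl \<in> carrier_mat m m"
  "H_s P Fl \<in> carrier_mat m m" "H_n P Fl \<in> carrier_mat m m"
  "H_w P Fr \<in> carrier_mat m m" "H_e P Fr \<in> carrier_mat m m"
  "H_s P Fr \<in> carrier_mat m m" "H_n P Fr \<in> carrier_mat m m"
  by (simp_all add: L.boundary_quadrature_eq R.boundary_quadrature_eq)

lemma block_H_carrier [simp]: "block_H P Fl \<in> carrier_mat n n" "block_H P Fr \<in> carrier_mat n n"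
  by (simp_all add: L.block_H_eq R.block_H_eq)

text \<open>The correction in \<open>Lap_tilde_plus\<close> before
  \<open>minv (H_plus P Fl Fr)\<close> is applied. Its lower blocks vanish, so it modifies only the
  equations of the left block.\<close>

definition interface_mat :: "real mat" where
  "interface_mat = four_block_mat (transpose_mat (e_e P) * H_e P Fl * d_e P Fl)
     (transpose_mat (e_e P) * H_e P Fl * d_w P Fr) (0\<^sub>m n n) (0\<^sub>m n n)"

lemma interface_mat_carrier: "interface_mat \<in> carrier_mat (n + n) (n + n)"
  unfolding interface_mat_def
  by (intro four_block_carrier_mat mult_carrier_mat[of _ n m] mult_carrier_mat[of _ m m]) auto

text \<open>Both terms are tested with the east values of \<open>a\<close>, since the lower half of
  the image is zero. The second pairs them with the normal derivative taken from the right block,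
  which is why continuity is needed to match it with a west term.\<close>

lemma interface_term:
  assumes a: "a \<in> carrier_vec n" and b: "b \<in> carrier_vec n"
    and c: "c \<in> carrier_vec n" and d: "d \<in> carrier_vec n"
  shows "(a @\<^sub>v b) \<bullet> (interface_mat *\<^sub>v (c @\<^sub>v d))
    = ip (H_e P Fl) (e_e P *\<^sub>v a) (d_e P Fl *\<^sub>v c) + ip (H_e P Fl) (e_e P *\<^sub>v a) (d_w P Fr *\<^sub>v d)"
proof -
  have T: "transpose_mat (e_e P) \<in> carrier_mat n m" by simp
  have TH: "transpose_mat (e_e P) * H_e P Fl \<in> carrier_mat n m"
    by (rule mult_carrier_mat[OF T]) simp
  have THd: "transpose_mat (e_e P) * H_e P Fl * d_e P Fl \<in> carrier_mat n n"
    "transpose_mat (e_e P) * H_e P Fl * d_w P Fr \<in> carrier_mat n n"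
    using mult_carrier_mat[OF TH L.d_carrier(2)] mult_carrier_mat[OF TH R.d_carrier(1)] .
  have dc: "d_e P Fl *\<^sub>v c \<in> carrier_vec m" "d_w P Fr *\<^sub>v d \<in> carrier_vec m"
    using mult_mat_vec_carrier[OF L.d_carrier(2) c] mult_mat_vec_carrier[OF R.d_carrier(1) d] .
  have *: "transpose_mat (e_e P) * H_e P Fl * M *\<^sub>v x = transpose_mat (e_e P) *\<^sub>v (H_e P Fl *\<^sub>v (M *\<^sub>v x))"
    if "M \<in> carrier_mat m n" "x \<in> carrier_vec n" for M x
    using assoc_mult_mat_vec[OF TH that] assoc_mult_mat_vec[OF T boundary_quadrature_carrier(2) mult_mat_vec_carrier[OF that]]
    by simp
  have cn: "transpose_mat (e_e P) *\<^sub>v y \<in> carrier_vec n" if "y \<in> carrier_vec m" for y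
    using mult_mat_vec_carrier[OF T that] .
  have Z: "0\<^sub>m n n *\<^sub>v c + 0\<^sub>m n n *\<^sub>v d = 0\<^sub>v n"
    using c d by (intro eq_vecI) (auto simp: index_mult_mat_vec)
  have "interface_mat *\<^sub>v (c @\<^sub>v d) = (transpose_mat (e_e P) *\<^sub>v (H_e P Fl *\<^sub>v (d_e P Fl *\<^sub>v c))
      + transpose_mat (e_e P) *\<^sub>v (H_e P Fl *\<^sub>v (d_w P Fr *\<^sub>v d))) @\<^sub>v 0\<^sub>v n"
    unfolding interface_mat_def
      four_block_mat_mult_vec[OF THd zero_carrier_mat[of n n] zero_carrier_mat[of n n] c d]
      *[OF L.d_carrier(2) c] *[OF R.d_carrier(1) d] Z ..
  then have "(a @\<^sub>v b) \<bullet> (interface_mat *\<^sub>v (c @\<^sub>v d))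
      = a \<bullet> (transpose_mat (e_e P) *\<^sub>v (H_e P Fl *\<^sub>v (d_e P Fl *\<^sub>v c))
        + transpose_mat (e_e P) *\<^sub>v (H_e P Fl *\<^sub>v (d_w P Fr *\<^sub>v d))) + b \<bullet> 0\<^sub>v n"
    using scalar_prod_append[OF a b _ zero_carrier_vec] cn dc
    by (simp add: mult_mat_vec_carrier[of _ m m])
  also have "\<dots> = a \<bullet> (transpose_mat (e_e P) *\<^sub>v (H_e P Fl *\<^sub>v (d_e P Fl *\<^sub>v c)))
        + a \<bullet> (transpose_mat (e_e P) *\<^sub>v (H_e P Fl *\<^sub>v (d_w P Fr *\<^sub>v d)))"
    using a b cn dc scalar_prod_add_distrib[OF a, of "transpose_mat (e_e P) *\<^sub>v (H_e P Fl *\<^sub>v (d_e P Fl *\<^sub>v c))"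
       "transpose_mat (e_e P) *\<^sub>v (H_e P Fl *\<^sub>v (d_w P Fr *\<^sub>v d))"]
    by (simp add: mult_mat_vec_carrier[of _ m m])
  also have "\<dots> = ip (H_e P Fl) (e_e P *\<^sub>v a) (d_e P Fl *\<^sub>v c) + ip (H_e P Fl) (e_e P *\<^sub>v a) (d_w P Fr *\<^sub>v d)"
    using ip_transpose[OF side_carrier(2) boundary_quadrature_carrier(2) a dc(1)]
      ip_transpose[OF side_carrier(2) boundary_quadrature_carrier(2) a dc(2)] by simp
  finally show ?thesis .
qed

lemma Lap_plus_carrier: "Lap_plus P Fl Fr \<in> carrier_mat (n + n) (n + n)"
  by (simp add: Lap_plus_def)

text \<open>In the weighted inner product each entry \<open>hj i\<close> cancels the
  \<open>inverse (hj i)\<close> in the correction, leaving an unweighted pairing with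
  \<open>interface_mat\<close>.\<close>

lemma Lap_tilde_plus_carrier: "Lap_tilde_plus P Fl Fr \<in> carrier_mat (n + n) (n + n)"
  and ip_Lap_tilde_plus:
  "x \<in> carrier_vec (n + n) \<Longrightarrow> y \<in> carrier_vec (n + n) \<Longrightarrow>
    ip (H_plus P Fl Fr) x (Lap_tilde_plus P Fl Fr *\<^sub>v y)
    = ip (H_plus P Fl Fr) x (Lap_plus P Fl Fr *\<^sub>v y) - x \<bullet> (interface_mat *\<^sub>v y)"
proof -
  let ?K = "mat_diag (n + n) (\<lambda>i. inverse (hj i))"
  have K: "minv (H_plus P Fl Fr) = ?K"
    unfolding H_plus_eq using hj_pos by (intro minv_mat_diag) (metis less_irrefl)
  have eq: "Lap_tilde_plus P Fl Fr = Lap_plus P Fl Fr - ?K * interface_mat"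
    by (simp add: Lap_tilde_plus_def Let_def K interface_mat_def)
  have KI: "?K * interface_mat \<in> carrier_mat (n + n) (n + n)"
    by (rule mult_carrier_mat[OF mat_diag_dim interface_mat_carrier])
  show "Lap_tilde_plus P Fl Fr \<in> carrier_mat (n + n) (n + n)"
    unfolding eq by (rule minus_carrier_mat[OF KI])
  assume x: "x \<in> carrier_vec (n + n)" and y: "y \<in> carrier_vec (n + n)"
  have Iy: "interface_mat *\<^sub>v y \<in> carrier_vec (n + n)"
    and Ly: "Lap_plus P Fl Fr *\<^sub>v y \<in> carrier_vec (n + n)"
    using mult_mat_vec_carrier[OF interface_mat_carrier y] mult_mat_vec_carrier[OF Lap_plus_carrier y] .
  have "Lap_tilde_plus P Fl Fr *\<^sub>v y = Lap_plus P Fl Fr *\<^sub>v y - ?K *\<^sub>v (interface_mat *\<^sub>v y)"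
    unfolding eq minus_mult_distrib_mat_vec[OF Lap_plus_carrier KI y]
      assoc_mult_mat_vec[OF mat_diag_dim interface_mat_carrier y] ..
  also have "\<dots> = vec (n + n) (\<lambda>i. (Lap_plus P Fl Fr *\<^sub>v y) $ i - inverse (hj i) * (interface_mat *\<^sub>v y) $ i)"
    using Ly by (auto simp: mat_diag_mult_vec[OF Iy])
  finally have "ip (H_plus P Fl Fr) x (Lap_tilde_plus P Fl Fr *\<^sub>v y)
      = (\<Sum>i<n + n. hj i * x $ i * ((Lap_plus P Fl Fr *\<^sub>v y) $ i - inverse (hj i) * (interface_mat *\<^sub>v y) $ i))"
    by (simp add: H_plus_eq ip_mat_diag)
  also have "\<dots> = (\<Sum>i<n + n. hj i * x $ i * (Lap_plus P Fl Fr *\<^sub>v y) $ i - x $ i * (interface_mat *\<^sub>v y) $ i)"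
  proof (rule sum.cong[OF refl])
    fix i assume "i \<in> {..<n + n}"
    then show "hj i * x $ i * ((Lap_plus P Fl Fr *\<^sub>v y) $ i - inverse (hj i) * (interface_mat *\<^sub>v y) $ i)
      = hj i * x $ i * (Lap_plus P Fl Fr *\<^sub>v y) $ i - x $ i * (interface_mat *\<^sub>v y) $ i"
      using hj_pos[of i] by (simp add: field_simps)
  qed
  also have "\<dots> = ip (H_plus P Fl Fr) x (Lap_plus P Fl Fr *\<^sub>v y) - x \<bullet> (interface_mat *\<^sub>v y)"
    using carrier_vecD[OF Iy]
    by (simp only: H_plus_eq ip_mat_diag[OF Ly] sum_subtractf scalar_prod_def atLeast0LessThan)
  finally show "ip (H_plus P Fl Fr) x (Lap_tilde_plus P Fl Fr *\<^sub>v y)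
    = ip (H_plus P Fl Fr) x (Lap_plus P Fl Fr *\<^sub>v y) - x \<bullet> (interface_mat *\<^sub>v y)" .
qed

text \<open>Adding the two block identities leaves an unwanted east term on the left and west term
  on the right. The continuity condition is imposed on the test pair \<open>a\<close>,
  \<open>b\<close> because \<open>c\<close> and \<open>d\<close> enter these terms only through
  normal derivatives.\<close>

lemma ip_Lap_tilde_plus_append:
  assumes a: "a \<in> carrier_vec n" and b: "b \<in> carrier_vec n"
    and c: "c \<in> carrier_vec n" and d: "d \<in> carrier_vec n"
    and interface: "e_e P *\<^sub>v a = e_w P *\<^sub>v b"
  shows "ip (H_plus P Fl Fr) (a @\<^sub>v b) (Lap_tilde_plus P Fl Fr *\<^sub>v (c @\<^sub>v d)) =
      - ip (H_plus P Fl Fr) (Dx_plus P Fl Fr *\<^sub>v (a @\<^sub>v b)) (Dx_plus P Fl Fr *\<^sub>v (c @\<^sub>v d))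
      - ip (H_plus P Fl Fr) (Dy_plus P Fl Fr *\<^sub>v (a @\<^sub>v b)) (Dy_plus P Fl Fr *\<^sub>v (c @\<^sub>v d))
      + (ip (H_n P Fl) (e_n P *\<^sub>v a) (d_n P Fl *\<^sub>v c) + ip (H_n P Fr) (e_n P *\<^sub>v b) (d_n P Fr *\<^sub>v d))
      + (ip (H_s P Fl) (e_s P *\<^sub>v a) (d_s P Fl *\<^sub>v c) + ip (H_s P Fr) (e_s P *\<^sub>v b) (d_s P Fr *\<^sub>v d))
      + (ip (H_w P Fl) (e_w P *\<^sub>v a) (d_w P Fl *\<^sub>v c) + ip (H_e P Fr) (e_e P *\<^sub>v b) (d_e P Fr *\<^sub>v d))"
proof -
  have ab: "a @\<^sub>v b \<in> carrier_vec (n + n)" "c @\<^sub>v d \<in> carrier_vec (n + n)"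
    using a b c d by auto
  have split: "ip (H_plus P Fl Fr) (p @\<^sub>v q) (r @\<^sub>v t) = ip (block_H P Fl) p r + ip (block_H P Fr) q t"
    if "p \<in> carrier_vec n" "q \<in> carrier_vec n" "r \<in> carrier_vec n" "t \<in> carrier_vec n" for p q r t
    unfolding H_plus_def using block_H_carrier that by (rule ip_bdiag)
  have Lc: "block_Lap P Fl *\<^sub>v c \<in> carrier_vec n" "block_Lap P Fr *\<^sub>v d \<in> carrier_vec n"
    using mult_mat_vec_carrier[OF L.block_Lap_carrier c] mult_mat_vec_carrier[OF R.block_Lap_carrier d] .
  note L.D_xy_vec_carrier R.D_xy_vec_carrier
  then show ?thesis
    unfolding ip_Lap_tilde_plus[OF ab] interface_term[OF a b c d]
      Lap_plus_def Dx_plus_def Dy_plus_def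
      bdiag_mult_vec[OF L.block_Lap_carrier R.block_Lap_carrier c d]
      bdiag_mult_vec[OF L.D_x_carrier R.D_x_carrier c d] bdiag_mult_vec[OF L.D_x_carrier R.D_x_carrier a b]
      bdiag_mult_vec[OF L.D_y_carrier R.D_y_carrier c d] bdiag_mult_vec[OF L.D_y_carrier R.D_y_carrier a b]
      split[OF a b Lc]
    by (simp add: split L.block_sbp[OF a c] R.block_sbp[OF b d] quadrature_interface interface)
qed

lemma reduced_sbp:
  assumes S_hat: "distinct_points_of (grid_points P Fl Fr) S_hat"
    and E: "E = embedding (grid_points P Fl Fr) S_hat"
    and u: "u \<in> carrier_vec (dim_row S_hat)" and v: "v \<in> carrier_vec (dim_row S_hat)"
  shows "ip (H_red P Fl Fr E) u (Lap_red P Fl Fr E *\<^sub>v v) =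
      - ip (H_plus P Fl Fr) (Dx_plus P Fl Fr * E *\<^sub>v u) (Dx_plus P Fl Fr * E *\<^sub>v v)
      - ip (H_plus P Fl Fr) (Dy_plus P Fl Fr * E *\<^sub>v u) (Dy_plus P Fl Fr * E *\<^sub>v v)
      + boundary_terms P Fl Fr E u v"
proof -
  let ?S = "grid_points P Fl Fr" and ?k = "dim_row S_hat"
  have dim_S: "dim_row ?S = n + n" by (simp add: grid_points_def)
  obtain s where emb: "embedding ?S S_hat = selection (n + n) ?k s" and s_less: "\<And>i. i < n + n \<Longrightarrow> s i < ?k"
    and s_surj: "\<And>j. j < ?k \<Longrightarrow> \<exists>i<n + n. s i = j"
    and s_eq: "\<And>i j. i < n + n \<Longrightarrow> j < n + n \<Longrightarrow> row ?S i = row ?S j \<Longrightarrow> s i = s j"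
    using embedding_selection[OF S_hat, unfolded dim_S] by blast
  have E_eq: "E = selection (n + n) ?k s" unfolding E by (rule emb)
  have Ec: "E \<in> carrier_mat (n + n) ?k" by (simp add: E_eq)
  have Hc: "H_plus P Fl Fr \<in> carrier_mat (n + n) (n + n)" by (simp add: H_plus_eq)

  define hr where "hr j = (\<Sum>i | i < n + n \<and> s i = j. hj i)" for j
  have H_red_eq: "H_red P Fl Fr E = mat_diag ?k hr"
    unfolding H_red_def H_plus_eq E_eq hr_def[abs_def] by (rule selection_diag_conj_transpose)
  \<comment> \<open>Every column of the embedding is hit by some grid point, so the sum defining
    \<open>hr j\<close> is nonempty.\<close>
  have "0 < hr j" if "j < ?k" for j
    unfolding hr_def using s_surj[OF that] by (intro sum_pos) (auto intro: hj_pos)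
  then have hr: "hr j \<noteq> 0" if "j < ?k" for j using that by force
  have minv: "minv (H_red P Fl Fr E) = mat_diag ?k (\<lambda>j. inverse (hr j))"
    unfolding H_red_eq by (rule minv_mat_diag) (rule hr)
  have inv: "minv (H_red P Fl Fr E) \<in> carrier_mat ?k ?k"
    unfolding minv by simp
  have "H_red P Fl Fr E * minv (H_red P Fl Fr E) = mat_diag ?k (\<lambda>j. hr j * inverse (hr j))"
    \<comment> \<open>The order matters: rewriting \<open>H_red\<close> first would destroy the left
      side of the equation for its inverse.\<close>
    unfolding minv unfolding H_red_eq by simp
  also have "\<dots> = mat_diag ?k (\<lambda>j. 1)" by (rule mat_diag_cong) (simp add: hr)
  finally have inv': "H_red P Fl Fr E * minv (H_red P Fl Fr E) = 1\<^sub>m ?k" by simp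
  have reduce: "ip (H_red P Fl Fr E) u (Lap_red P Fl Fr E *\<^sub>v v)
    = ip (H_plus P Fl Fr) (E *\<^sub>v u) (Lap_tilde_plus P Fl Fr *\<^sub>v (E *\<^sub>v v))"
    unfolding Lap_red_def unfolding H_red_def
    by (rule ip_congruence[OF Ec Hc Lap_tilde_plus_carrier inv[unfolded H_red_def] inv'[unfolded H_red_def] u v])

  have Eu: "E *\<^sub>v u = vec (n + n) (\<lambda>i. u $ s i)"
    unfolding E_eq by (rule selection_mult_vec[OF s_less u])
  \<comment> \<open>Halves of the embedded vectors belonging to the left and the right
    block.\<close>
  define a b where "a = vec_first (E *\<^sub>v u) n" and "b = vec_last (E *\<^sub>v u) n"
  define c d where "c = vec_first (E *\<^sub>v v) n" and "d = vec_last (E *\<^sub>v v) n"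
  have car: "a \<in> carrier_vec n" "b \<in> carrier_vec n" "c \<in> carrier_vec n" "d \<in> carrier_vec n"
    by (simp_all add: a_def b_def c_def d_def)
  have Euv: "E *\<^sub>v u = a @\<^sub>v b" "E *\<^sub>v v = c @\<^sub>v d"
    using mult_mat_vec_carrier[OF Ec u] mult_mat_vec_carrier[OF Ec v]
    by (simp_all add: a_def b_def c_def d_def)
  \<comment> \<open>Both entries are the same component of \<open>u\<close>, because
    \<open>s\<close> identifies the two copies of the interface point.\<close>
  have "a $ east j = b $ west j" if j: "j < m" for j
    using side_less[OF j] s_eq[OF _ _ row_grid_points_interface[OF j]]
    by (simp add: a_def b_def vec_first_def vec_last_def Eu)
  then have interface: "e_e P *\<^sub>v a = e_w P *\<^sub>v b"
    using car by (auto simp: e_eq selection_mult_vec)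

  have restrict: "bdiag A B * E *\<^sub>v u = A *\<^sub>v a @\<^sub>v B *\<^sub>v b" "bdiag A B * E *\<^sub>v v = A *\<^sub>v c @\<^sub>v B *\<^sub>v d"
    if A: "A \<in> carrier_mat r n" and B: "B \<in> carrier_mat r n" for A B r
    unfolding assoc_mult_mat_vec[OF bdiag_carrier[OF A B] Ec u]
      assoc_mult_mat_vec[OF bdiag_carrier[OF A B] Ec v] Euv
      bdiag_mult_vec[OF A B car(1,2)] bdiag_mult_vec[OF A B car(3,4)] by (rule refl)+
  have side: "ip (bdiag H H') (bdiag A A' * E *\<^sub>v u) (bdiag B B' * E *\<^sub>v v)
      = ip H (A *\<^sub>v a) (B *\<^sub>v c) + ip H' (A' *\<^sub>v b) (B' *\<^sub>v d)"
    if H: "H \<in> carrier_mat m m" "H' \<in> carrier_mat m m"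
      and A: "A \<in> carrier_mat m n" "A' \<in> carrier_mat m n"
      and B: "B \<in> carrier_mat m n" "B' \<in> carrier_mat m n" for H H' A A' B B'
    unfolding restrict[OF A] restrict[OF B]
    by (rule ip_bdiag[OF H]) (use A B car in auto)
  have boundary: "boundary_terms P Fl Fr E u v
     = (ip (H_n P Fl) (e_n P *\<^sub>v a) (d_n P Fl *\<^sub>v c) + ip (H_n P Fr) (e_n P *\<^sub>v b) (d_n P Fr *\<^sub>v d))
      + (ip (H_s P Fl) (e_s P *\<^sub>v a) (d_s P Fl *\<^sub>v c) + ip (H_s P Fr) (e_s P *\<^sub>v b) (d_s P Fr *\<^sub>v d))
      + (ip (H_w P Fl) (e_w P *\<^sub>v a) (d_w P Fl *\<^sub>v c) + ip (H_e P Fr) (e_e P *\<^sub>v b) (d_e P Fr *\<^sub>v d))"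
    unfolding boundary_terms_def e_bd1_def d_bd1_def H_bd1_def e_bd2_def d_bd2_def H_bd2_def
      e_bd3_def d_bd3_def H_bd3_def
    by (simp add: side)
  have D: "Dx_plus P Fl Fr * E *\<^sub>v u = Dx_plus P Fl Fr *\<^sub>v (a @\<^sub>v b)"
    "Dx_plus P Fl Fr * E *\<^sub>v v = Dx_plus P Fl Fr *\<^sub>v (c @\<^sub>v d)"
    "Dy_plus P Fl Fr * E *\<^sub>v u = Dy_plus P Fl Fr *\<^sub>v (a @\<^sub>v b)"
    "Dy_plus P Fl Fr * E *\<^sub>v v = Dy_plus P Fl Fr *\<^sub>v (c @\<^sub>v d)"
  proof -
    have "Dx_plus P Fl Fr \<in> carrier_mat (n + n) (n + n)" "Dy_plus P Fl Fr \<in> carrier_mat (n + n) (n + n)"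
      by (simp_all add: Dx_plus_def Dy_plus_def)
    from assoc_mult_mat_vec[OF this(1) Ec] assoc_mult_mat_vec[OF this(2) Ec]
    show "Dx_plus P Fl Fr * E *\<^sub>v u = Dx_plus P Fl Fr *\<^sub>v (a @\<^sub>v b)"
      "Dx_plus P Fl Fr * E *\<^sub>v v = Dx_plus P Fl Fr *\<^sub>v (c @\<^sub>v d)"
      "Dy_plus P Fl Fr * E *\<^sub>v u = Dy_plus P Fl Fr *\<^sub>v (a @\<^sub>v b)"
      "Dy_plus P Fl Fr * E *\<^sub>v v = Dy_plus P Fl Fr *\<^sub>v (c @\<^sub>v d)"
      using u v by (simp_all add: Euv)
  qed
  show ?thesis
    unfolding reduce D boundary Euv ip_Lap_tilde_plus_append[OF car interface] by simp
qed

end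

theorem lemma3p1:
  fixes P :: sbp_ops and Fl Fr :: block and S S_hat E :: "real mat" and u v :: "real vec"
  assumes "is_sbp P"
    and "two_block_domain P Fl Fr"
    and "S = grid_points P Fl Fr"
    and "distinct_points_of S S_hat"
    and "E = embedding S S_hat"
    and "u \<in> carrier_vec (dim_row S_hat)"
    and "v \<in> carrier_vec (dim_row S_hat)"
  shows "ip (H_red P Fl Fr E) u (Lap_red P Fl Fr E *\<^sub>v v) =
      - ip (H_plus P Fl Fr) (Dx_plus P Fl Fr * E *\<^sub>v u) (Dx_plus P Fl Fr * E *\<^sub>v v)
      - ip (H_plus P Fl Fr) (Dy_plus P Fl Fr * E *\<^sub>v u) (Dy_plus P Fl Fr * E *\<^sub>v v)
      + boundary_terms P Fl Fr E u v"
proof -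
  have "positive_Jacobian P Fl" "positive_Jacobian P Fr"
    using assms(2) by (simp_all add: two_block_domain_def Let_def)
  then interpret two_block P Fl Fr
    using assms(1,2) by unfold_locales
  show ?thesis using assms(4-7) unfolding assms(3) by (rule reduced_sbp)
qed

end
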